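(* Let $T(n)$ denote the maximum number of tangent pairs in a family of $n$ $x$-monotone planar curves such that every two curves have at most one common point, no three curves share a common point, and the left endpoints of all curves lie on a common vertical line. Then $T(n)=\Theta(n^{4/3})$.
   Context: A curve is $x$-monotone if it is the graph of a continuous function defined on a closed interval of $\mathbb{R}$; its left endpoint is the point of the curve with smallest $x$-coordinate. Every two curves of a family are assumed to intersect in finitely many points. Two curves are tangent if they have precisely one common point and this point is not a crossing point. *)

theory Defs
  imports Complex_Main "HOL-Library.Landau_Symbols"
begin

type_synonym point = "real \<times> real"

(* The interval is nondegenerate and bounded: a curve is an arc, not a single point. *)
definition x_monotone :: "point set \<Rightarrow> bool" where
  "x_monotone C \<longleftrightarrow>
     (\<exists>f a b. a < b \<and> continuous_on {a..b} f \<and> C = (\<lambda>x. (x, f x)) ` {a..b})"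

definition left_endpoint :: "point set \<Rightarrow> point" where
  "left_endpoint C = arg_min_on fst C"

(* Only meant for x-monotone curves, which have at most one point above each x.
   Both curves are required to be present over all of I. *)
definition strictly_below_on :: "real set \<Rightarrow> point set \<Rightarrow> point set \<Rightarrow> bool" where
  "strictly_below_on I A B \<longleftrightarrow> (\<forall>x\<in>I. \<exists>u v. (x, u) \<in> A \<and> (x, v) \<in> B \<and> u < v)"

(* The curves exchange sides at p. In particular p is an interior point of both curves, so a
   common point that is an endpoint of one of the curves is not a crossing point. *)
definition crossing_point :: "point set \<Rightarrow> point set \<Rightarrow> point \<Rightarrow> bool" where
  "crossing_point A B p \<longleftrightarrow> p \<in> A \<inter> B \<and>
     (\<exists>e>0. (strictly_below_on {fst p - e<..<fst p} A B \<and> strictly_below_on {fst p<..<fst p + e} B A)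
          \<or> (strictly_below_on {fst p - e<..<fst p} B A \<and> strictly_below_on {fst p<..<fst p + e} A B))"

definition tangent :: "point set \<Rightarrow> point set \<Rightarrow> bool" where
  "tangent A B \<longleftrightarrow> (\<exists>p. A \<inter> B = {p} \<and> \<not> crossing_point A B p)"

definition tangent_pairs :: "point set set \<Rightarrow> point set set set" where
  "tangent_pairs F = {{A, B} | A B. A \<in> F \<and> B \<in> F \<and> A \<noteq> B \<and> tangent A B}"

(* Members of a family may be taken to be distinct as point sets: two equal curves would have
   infinitely many common points. *)
definition admissible_family :: "nat \<Rightarrow> point set set \<Rightarrow> bool" where
  "admissible_family n F \<longleftrightarrow>
     finite F \<and> card F = n \<and>
     (\<forall>C\<in>F. x_monotone C) \<and>
     (\<forall>A\<in>F. \<forall>B\<in>F. A \<noteq> B \<longrightarrow> finite (A \<inter> B) \<and> card (A \<inter> B) \<le> 1) \<and>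
     (\<forall>A\<in>F. \<forall>B\<in>F. \<forall>C\<in>F. A \<noteq> B \<and> A \<noteq> C \<and> B \<noteq> C \<longrightarrow> A \<inter> B \<inter> C = {}) \<and>
     (\<exists>c. \<forall>C\<in>F. fst (left_endpoint C) = c)"

definition T :: "nat \<Rightarrow> nat" where
  "T n = Max {card (tangent_pairs F) | F. admissible_family n F}"

lemma left_endpoint_graph:
  assumes "a \<le> (b::real)"
  shows "left_endpoint ((\<lambda>x. (x, f x)) ` {a..b}) = (a, f a)"
  unfolding left_endpoint_def arg_min_on_def arg_min_def is_arg_min_def
proof (rule some_equality)
  fix p
  assume p: "p \<in> (\<lambda>x. (x, f x)) ` {a..b} \<and>
    \<not> (\<exists>q. q \<in> (\<lambda>x. (x, f x)) ` {a..b} \<and> fst q < fst p)"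
  then obtain x where x: "p = (x, f x)" "a \<le> x" by auto
  have "(a, f a) \<in> (\<lambda>x. (x, f x)) ` {a..b}" using assms by simp
  with p x have "\<not> a < x" by (metis fst_conv)
  with x show "p = (a, f a)" by simp
qed (use assms in auto)

(* The maximum defining T ranges over a finite nonempty set. *)

lemma finite_tangency_counts:
  "finite {card (tangent_pairs F) | F. admissible_family n F}"
proof (rule finite_subset)
  show "{card (tangent_pairs F) | F. admissible_family n F} \<subseteq> {..2 ^ n}"
  proof
    fix k assume "k \<in> {card (tangent_pairs F) | F. admissible_family n F}"
    then obtain F where k: "k = card (tangent_pairs F)" and F: "admissible_family n F"
      by auto
    have "tangent_pairs F \<subseteq> Pow F"
      by (auto simp: tangent_pairs_def)
    then show "k \<in> {..2 ^ n}"
      using k F card_mono[of "Pow F" "tangent_pairs F"]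
      by (auto simp: admissible_family_def card_Pow)
  qed
qed simp

lemma tangency_counts_nonempty:
  "{card (tangent_pairs F) | F. admissible_family n F} \<noteq> {}"
proof -
  define s :: "nat \<Rightarrow> point set" where "s i = (\<lambda>x. (x, real i)) ` {0..1}" for i
  have disj: "s i \<inter> s j = {}" if "i \<noteq> j" for i j
    using that by (auto simp: s_def)
  have ne: "s i \<noteq> {}" for i
    by (simp add: s_def)
  have "inj s"
    by (rule injI) (metis disj ne inf.idem)
  then have card: "card (s ` {..<n}) = n"
    by (simp add: card_image inj_on_subset)
  have mono: "x_monotone (s i)" for i
    unfolding x_monotone_def s_def
    by (rule exI[of _ "\<lambda>_. real i"], rule exI[of _ 0], rule exI[of _ 1]) simp
  have left: "left_endpoint (s i) = (0, real i)" for i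
    unfolding s_def by (rule left_endpoint_graph) simp
  have int: "A \<inter> B = {}" if "A \<in> s ` {..<n}" "B \<in> s ` {..<n}" "A \<noteq> B" for A B
    using that disj by (metis imageE)
  have "admissible_family n (s ` {..<n})"
    unfolding admissible_family_def
  proof (intro conjI)
    show "\<forall>A\<in>s ` {..<n}. \<forall>B\<in>s ` {..<n}. A \<noteq> B \<longrightarrow> finite (A \<inter> B) \<and> card (A \<inter> B) \<le> 1"
    proof (intro ballI impI)
      fix A B assume "A \<in> s ` {..<n}" "B \<in> s ` {..<n}" "A \<noteq> B"
      then have "A \<inter> B = {}" by (rule int)
      then show "finite (A \<inter> B) \<and> card (A \<inter> B) \<le> 1" by simp
    qed
    show "\<forall>A\<in>s ` {..<n}. \<forall>B\<in>s ` {..<n}. \<forall>C\<in>s ` {..<n}.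
        A \<noteq> B \<and> A \<noteq> C \<and> B \<noteq> C \<longrightarrow> A \<inter> B \<inter> C = {}"
      using int by (metis inf_bot_left)
    show "\<exists>c. \<forall>C\<in>s ` {..<n}. fst (left_endpoint C) = c"
      by (rule exI[of _ 0]) (simp add: left)
  qed (simp_all add: card mono)
  then show ?thesis by blast
qed

end

theory Submission
  imports Defs "HOL-Library.FuncSet"
begin

text \<open>Lower bound: lines and parabola translates turn point-line incidences of an integer grid into
  tangencies.

  Upper bound: splitting the family at the median right endpoint, with a geometric series as
  result, it suffices to count the pairs where a curve of \<open>L\<close> touches from below a curve of \<open>J\<close>,
  all curves of \<open>J\<close> living at least as long as those of \<open>L\<close>. Read the \<open>x\<close>-axis as time. Two curves
  of \<open>J\<close> touched consecutively by the same \<open>i \<in> L\<close> cross in between, which gives a graph on \<open>J\<close>.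
  Edges of this graph cross (form a diamond) if the crossing point of each lies between the two
  curves of the other. A graph without diamonds has at most \<open>3 |J|\<close> edges, two curves of \<open>L\<close>
  contribute at most four diamonds, so the random sampling proof of the crossing lemma gives
  \<open>O(n powr (4/3))\<close> distinct edges. An edge can arise from several \<open>i\<close>, but only if all but one of
  them die before the next one reaches the second curve; discarding \<open>O(n powr (1/3))\<close> edges of each
  \<open>i\<close> leaves three classes without repetition.\<close>

section \<open>Families of curves over a common left endpoint\<close>

text \<open>Curves that start on one vertical line and meet at most once behave like pseudolines:
  the vertical order of two of them changes at most once. Most contradictions below exhibit a second
  change (\<open>no_double_swap\<close>); the absence of triple points supplies the strict
  inequalities. The crossing lemma counts edges without multiplicity, so repeated edges are the
  obstacle. If no curve of \<open>L\<close> died early, there would be none, since two curves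
  producing the same edge would have to swap twice. Repetition is caused by deaths alone, hence the
  number of deaths so far is used as a clock. It stays below \<open>k ^ 3\<close>, so it has three
  digits in base \<open>k\<close>. The same \<open>k\<close>, about the cube root of the size
  \<open>N\<close>, is the inverse sampling probability: it balances the vertex term
  \<open>N * k\<close> against the diamond term \<open>N ^ 2 / k ^ 2\<close>. In the lower bound,
  lines have integer offsets up to a small perturbation quadratic in the slope. Being small, it lets
  integrality decide every coincidence; being quadratic, it leaves a Vandermonde product that
  excludes three concurrent lines.\<close>

text \<open>Curve \<open>i\<close> is the graph of \<open>f i\<close> over \<open>{c..r i}\<close>; outside, the values of \<open>f i\<close> are junk.\<close>

locale curve_system =
  fixes F :: "'a set" and f :: "'a \<Rightarrow> real \<Rightarrow> real" and c :: real and r :: "'a \<Rightarrow> real"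
  assumes finite_F: "finite F"
    and cont: "i \<in> F \<Longrightarrow> continuous_on {c..r i} (f i)"
    and meet_once: "\<lbrakk>i \<in> F; j \<in> F; i \<noteq> j; c \<le> s; s \<le> r i; s \<le> r j; c \<le> t; t \<le> r i; t \<le> r j;
      f i s = f j s; f i t = f j t\<rbrakk> \<Longrightarrow> s = t"
    and no_triple: "\<lbrakk>i \<in> F; j \<in> F; k \<in> F; i \<noteq> j; i \<noteq> k; j \<noteq> k; c \<le> t; t \<le> r i; t \<le> r j; t \<le> r k;
      f i t = f j t; f i t = f k t\<rbrakk> \<Longrightarrow> False"
begin

lemma meet_between:
  assumes "i \<in> F" "j \<in> F" "c \<le> s" "s \<le> t" "t \<le> r i" "t \<le> r j" "f i s \<le> f j s" "f j t \<le> f i t"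
  shows "\<exists>u. s \<le> u \<and> u \<le> t \<and> f i u = f j u"
proof -
  have "continuous_on {s..t} (f i)" "continuous_on {s..t} (f j)"
    using assms cont[of i] cont[of j] by (auto intro: continuous_on_subset)
  then have "continuous_on {s..t} (\<lambda>u. f i u - f j u)"
    by (intro continuous_intros)
  from IVT'[OF _ _ \<open>s \<le> t\<close> this, of 0] assms show ?thesis by auto
qed

text \<open>The change of order before \<open>t\<close> forces a common point in
  \<open>[s, t]\<close>, and a change back would force one in \<open>[t, u]\<close>. They coincide,
  hence lie at \<open>t\<close>, where the curves differ.\<close>

lemma below_persists:
  assumes "i \<in> F" "j \<in> F" "c \<le> s" "s < t" "t \<le> u" "u \<le> r i" "u \<le> r j"
    and "f i s \<le> f j s" "f j t < f i t"
  shows "f j u < f i u"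
proof (rule ccontr)
  assume neg: "\<not> f j u < f i u"
  have "i \<noteq> j" using assms by auto
  obtain p where p: "s \<le> p" "p \<le> t" "f i p = f j p"
    using meet_between[of i j s t] assms by auto
  obtain q where q: "t \<le> q" "q \<le> u" "f j q = f i q"
    using meet_between[of j i t u] assms neg by auto
  have "p = q"
    by (rule meet_once[of i j]) (use p q assms \<open>i \<noteq> j\<close> in auto)
  then show False using p q assms by auto
qed

lemma below_before:
  assumes "i \<in> F" "j \<in> F" "c \<le> s" "s \<le> t" "t < u" "u \<le> r i" "u \<le> r j"
    and "f i t < f j t" "f j u \<le> f i u"
  shows "f i s < f j s"
proof (rule ccontr)
  assume neg: "\<not> f i s < f j s"
  have "i \<noteq> j" using assms by auto
  obtain p where p: "s \<le> p" "p \<le> t" "f j p = f i p"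
    using meet_between[of j i s t] assms neg by auto
  obtain q where q: "t \<le> q" "q \<le> u" "f i q = f j q"
    using meet_between[of i j t u] assms by auto
  have "p = q"
    by (rule meet_once[of i j]) (use p q assms \<open>i \<noteq> j\<close> in auto)
  then show False using p q assms by auto
qed

lemma no_double_swap:
  assumes "i \<in> F" "j \<in> F" "c \<le> s" "s < t" "t < u" "u \<le> r i" "u \<le> r j"
    and "f i s \<le> f j s" "f j t < f i t" "f i u \<le> f j u"
  shows False
  using below_persists[of i j s t u] assms by auto

text \<open>Directed: \<open>a\<close> is the curve that starts below. The time \<open>s\<close> may
  be the last common time of the two curves, which makes the final clause vacuous, but it is never
  \<open>c\<close>.\<close>

definition crosses :: "'a \<Rightarrow> 'a \<Rightarrow> real \<Rightarrow> bool" where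
  "crosses a b s \<longleftrightarrow> c < s \<and> s \<le> r a \<and> s \<le> r b \<and> f a s = f b s \<and>
     (\<forall>t. c \<le> t \<and> t < s \<longrightarrow> f a t < f b t) \<and>
     (\<forall>t. s < t \<and> t \<le> r a \<and> t \<le> r b \<longrightarrow> f b t < f a t)"

lemma crossesI:
  assumes "a \<in> F" "b \<in> F" "c \<le> s" "s < t" "t \<le> r a" "t \<le> r b" "f a s < f b s" "f b t < f a t"
  shows "\<exists>u. s < u \<and> u < t \<and> crosses a b u"
proof -
  obtain u where u: "s \<le> u" "u \<le> t" "f a u = f b u"
    using meet_between[of a b s t] assms by auto
  then have "u \<noteq> s" "u \<noteq> t" using assms by auto
  then have su: "s < u" "u < t" using u by auto
  have ne: "f a v \<noteq> f b v" if "c \<le> v" "v \<le> r a" "v \<le> r b" "v \<noteq> u" for v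
    using meet_once[of a b v u] that u assms su by auto
  have "f a v < f b v" if v: "c \<le> v" "v < u" for v
  proof (cases "v \<le> s")
    case True
    then show ?thesis using below_before[of a b v s t] assms v by auto
  next
    case False
    then have "\<not> f b v < f a v"
      using no_double_swap[of a b s v u] assms u su v by auto
    moreover have "f a v \<noteq> f b v" using ne assms u su v by auto
    ultimately show ?thesis by simp
  qed
  moreover have "f b v < f a v" if v: "u < v" "v \<le> r a" "v \<le> r b" for v
  proof (cases "t \<le> v")
    case True
    then show ?thesis using below_persists[of a b s t v] assms v by auto
  next
    case False
    then have "\<not> f a v < f b v"
      using no_double_swap[of b a u v t] assms u su v by auto
    moreover have "f a v \<noteq> f b v" using ne assms u su v by auto
    ultimately show ?thesis by simp
  qed
  ultimately show ?thesis
    using u su assms unfolding crosses_def by (intro exI[of _ u]) auto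
qed

lemma crosses_unique:
  assumes "a \<in> F" "b \<in> F" "crosses a b s" "crosses a b t"
  shows "s = t"
  using assms meet_once[of a b s t] unfolding crosses_def by force

end

section \<open>Curves of equal lifetime and their diamonds\<close>

locale pencil = curve_system +
  fixes J :: "'a set" and \<mu> :: real
  assumes J_sub: "J \<subseteq> F" and r_J: "a \<in> J \<Longrightarrow> r a = \<mu>"
begin

text \<open>Meant for crossing times \<open>s\<close> of \<open>(a, b)\<close> and \<open>t\<close>
  of \<open>(a', b')\<close>. Then \<open>f a s = f b s\<close> and \<open>f a' t = f b' t\<close>,
  so each crossing point lies strictly between the two curves of the other pair. The earlier
  crossing is listed first.\<close>

definition diamond :: "'a \<Rightarrow> 'a \<Rightarrow> real \<Rightarrow> 'a \<Rightarrow> 'a \<Rightarrow> real \<Rightarrow> bool" where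
  "diamond a b s a' b' t \<longleftrightarrow>
     s < t \<and> f a' s < f a s \<and> f a s < f b' s \<and> f b t < f a' t \<and> f a' t < f a t"

lemma crosses_J:
  assumes "crosses a b s" "a \<in> J" "b \<in> J"
  shows "c < s" "s \<le> \<mu>" "f a s = f b s"
    and "\<And>t. c \<le> t \<Longrightarrow> t < s \<Longrightarrow> f a t < f b t"
    and "\<And>t. s < t \<Longrightarrow> t \<le> \<mu> \<Longrightarrow> f b t < f a t"
  using assms by (auto simp: crosses_def r_J)

lemma crosses_neq: "crosses a b s \<Longrightarrow> a \<noteq> b"
  unfolding crosses_def by force

lemma no_triple_J:
  assumes "i \<in> J" "j \<in> J" "k \<in> J" "i \<noteq> j" "i \<noteq> k" "j \<noteq> k" "c \<le> t" "t \<le> \<mu>"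
    "f i t = f j t" "f i t = f k t"
  shows False
  using no_triple[of i j k t] assms J_sub by (auto simp: r_J)

text \<open>The curve \<open>a'\<close> is below \<open>z\<close>, hence below \<open>a\<close>, at
  \<open>w\<close>, and still below \<open>a\<close> at \<open>w'\<close>. If their order differed
  at \<open>s\<close> or \<open>t'\<close>, then \<open>a\<close> and \<open>a'\<close> would cross
  inside one of the wedges; both start below \<open>z\<close>, against the choice of
  \<open>z\<close>. Also \<open>b\<close> and \<open>d'\<close> start no lower than
  \<open>z\<close>, so \<open>d'\<close> is above \<open>z\<close> until \<open>w'\<close> and
  \<open>b\<close> falls below \<open>z\<close> after \<open>s\<close>. In the excluded case
  \<open>b = z = d'\<close>, and the two edges share an endpoint.\<close>

lemma wedge_diamond:
  assumes J: "a \<in> J" "b \<in> J" "d \<in> J" "a' \<in> J" "b' \<in> J" "d' \<in> J" "z \<in> J"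
    and ab: "crosses a b s" and ad: "crosses a d t" and st: "s < t"
    and ab': "crosses a' b' s'" and ad': "crosses a' d' t'" and st': "s' < t'"
    and z: "crosses a z w" "s \<le> w" "w \<le> t" and z': "crosses a' z w'" "s' \<le> w'" "w' \<le> t'"
    and ww': "w < w'"
    and min: "\<And>k v. k \<in> J \<Longrightarrow> s \<le> v \<Longrightarrow> v \<le> t \<Longrightarrow> crosses a k v \<Longrightarrow> f z c \<le> f k c"
    and min': "\<And>k v. k \<in> J \<Longrightarrow> s' \<le> v \<Longrightarrow> v \<le> t' \<Longrightarrow> crosses a' k v \<Longrightarrow> f z c \<le> f k c"
    and not_both: "\<not> (w = s \<and> w' = t')"
  shows "diamond a b s a' d' t'"
proof -
  have JF: "\<And>i. i \<in> J \<Longrightarrow> i \<in> F" using J_sub by auto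
  note AB = crosses_J[OF ab J(1,2)] and AD = crosses_J[OF ad J(1,3)]
    and AB' = crosses_J[OF ab' J(4,5)] and AD' = crosses_J[OF ad' J(4,6)]
    and Z = crosses_J[OF z(1) J(1,7)] and Z' = crosses_J[OF z'(1) J(4,7)]
  have le: "c < s" "t' \<le> \<mu>" using AB AD' by auto
  have zc: "f a c < f z c" "f a' c < f z c" using Z(4)[of c] Z(1) Z'(4)[of c] Z'(1) by auto
  have aw: "f a' w < f a w" using Z(3) Z'(4)[of w] Z(1) ww' by auto
  have aw': "f a' w' < f a w'" using Z'(2,3) Z(5)[of w'] ww' by auto
  have as: "f a' s < f a s"
  proof (rule ccontr)
    assume neg: "\<not> f a' s < f a s"
    then have sw: "s < w" using aw z(2) by (cases "s = w") auto
    have "\<exists>v. s \<le> v \<and> v \<le> t \<and> crosses a a' v"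
    proof (cases "f a s = f a' s")
      case True
      then have "a' = b"
        using no_triple_J[of a b a' s] J AB aw crosses_neq[OF ab] le by (metis less_eq_real_def less_irrefl)
      then show ?thesis using ab st by auto
    next
      case False
      then obtain v where "s < v" "v < w" "crosses a a' v"
        using crossesI[of a a' s w] J JF aw neg sw le Z by (auto simp: r_J)
      then show ?thesis using z by (intro exI[of _ v]) auto
    qed
    then obtain v where "s \<le> v" "v \<le> t" "crosses a a' v" by auto
    from min[OF J(4) this] zc show False by auto
  qed
  have at': "f a' t' < f a t'"
  proof (rule ccontr)
    assume neg: "\<not> f a' t' < f a t'"
    then have sw: "w' < t'" using aw' z'(3) by (cases "t' = w'") auto
    have "\<exists>v. s' \<le> v \<and> v \<le> t' \<and> crosses a' a v"
    proof (cases "f a t' = f a' t'")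
      case True
      then have "a = d'"
        using no_triple_J[of a' d' a t'] J AD' aw crosses_neq[OF ad'] le by (metis less_eq_real_def less_irrefl)
      then show ?thesis using ad' st' by (intro exI[of _ t']) auto
    next
      case False
      then obtain v where "w' < v" "v < t'" "crosses a' a v"
        using crossesI[of a' a w' t'] J JF aw' neg sw le Z' by (auto simp: r_J)
      then show ?thesis using z' by (intro exI[of _ v]) auto
    qed
    then obtain v where "s' \<le> v" "v \<le> t'" "crosses a' a v" by auto
    from min'[OF J(1) this] zc show False by auto
  qed
  have as_le: "f a s \<le> f z s"
    using Z(3) Z(4)[of s] le z(2) by (cases "s = w") auto
  have sd: "f a s < f d' s"
  proof (cases "d' = z")
    case True
    then have "w' = t'" using crosses_unique[OF _ _ ad'] z'(1) J JF by auto
    then have "s < w" using not_both z(2) by auto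
    then show ?thesis using Z(4)[of s] le True by auto
  next
    case False
    have "f z c \<le> f d' c" using min'[OF J(6) _ _ ad'] st' by auto
    moreover have "w' \<noteq> t'"
      using no_triple_J[of a' d' z t'] J False AD' Z' crosses_neq[OF ad'] crosses_neq[OF z'(1)] by auto
    then have "f z w' < f d' w'" using AD'(4)[of w'] Z'(1,3) z'(3) by auto
    ultimately have "f z s \<le> f d' s"
      using below_persists[of z d' c s w'] J JF le z(2) ww' Z'(2) by (force simp: r_J)
    moreover have "f a s \<noteq> f d' s" if "f z s = f a s"
    proof
      assume eq: "f a s = f d' s"
      have "d' \<noteq> a" using zc(1) \<open>f z c \<le> f d' c\<close> by auto
      then show False
        using no_triple_J[of a z d' s] J False crosses_neq[OF z(1)] that eq le Z z(2) by auto
    qed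
    ultimately show ?thesis using as_le by (cases "f z s = f a s") auto
  qed
  have bt: "f b t' < f a' t'"
  proof (cases "b = z")
    case True
    then have "w = s" using crosses_unique[OF _ _ ab] z(1) J JF by auto
    then have "w' < t'" using not_both z' by auto
    then show ?thesis using Z'(5)[of t'] le True by auto
  next
    case False
    have zb: "f z c \<le> f b c" using min[OF J(2) _ _ ab] st by auto
    have "w \<noteq> s"
      using no_triple_J[of a b z s] J False AB Z crosses_neq[OF ab] crosses_neq[OF z(1)] by auto
    then have "f b s < f z s" using Z(4)[of s] AB(3) le z(2) by auto
    then have "f b t' < f z t'"
      using below_persists[of z b c s t'] zb J JF le z z' ww' by (auto simp: r_J)
    moreover have "f z t' \<le> f a' t'"
      using Z'(3) Z'(5)[of t'] z'(3) le by (cases "w' = t'") auto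
    ultimately show ?thesis by simp
  qed
  show ?thesis
    unfolding diamond_def using as at' sd bt z z' ww' AD'(3) by auto
qed

end

section \<open>The crossing inequality\<close>

text \<open>The average of the assumed bound over the random sets that contain each element of \<open>J\<close> with
  probability \<open>1 / k\<close>.\<close>

lemma sampling_bound:
  fixes VE :: "'e \<Rightarrow> 'a set" and VD :: "'d \<Rightarrow> 'a set"
  assumes fin: "finite J" "finite E" "finite D" and k: "k \<ge> (1::nat)"
    and VE: "\<And>e. e \<in> E \<Longrightarrow> VE e \<subseteq> J \<and> card (VE e) = 2"
    and VD: "\<And>d. d \<in> D \<Longrightarrow> VD d \<subseteq> J \<and> card (VD d) = 4"
    and bound: "\<And>S. S \<subseteq> J \<Longrightarrow>
      card {e \<in> E. VE e \<subseteq> S} \<le> 3 * card S + card {d \<in> D. VD d \<subseteq> S}"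
  shows "real (card E) \<le> 3 * real (card J) * real k + real (card D) / real k ^ 2"
proof -
  \<comment> \<open>Counting replaces probability: a uniform \<open>g\<close> in \<open>G\<close>
    vanishes at each element of \<open>J\<close> independently with probability
    \<open>1 / k\<close>, and \<open>count\<close> is \<open>k ^ ?n\<close> times the probability
    that \<open>A\<close> survives.\<close>
  define G where "G = (\<Pi>\<^sub>E a\<in>J. {..<k})"
  define S where "S g = {a \<in> J. g a = (0::nat)}" for g :: "'a \<Rightarrow> nat"
  let ?n = "card J"
  have finG: "finite G" unfolding G_def by (intro finite_PiE fin) auto
  have count: "real (card {g \<in> G. A \<subseteq> S g}) = real k ^ ?n / real k ^ card A" if A: "A \<subseteq> J" for A
  proof -
    have "{g \<in> G. A \<subseteq> S g} = (\<Pi>\<^sub>E a\<in>J. if a \<in> A then {0} else {..<k})"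
      using A k unfolding G_def S_def by (auto simp: PiE_iff extensional_def split: if_splits)
    then have "card {g \<in> G. A \<subseteq> S g} = (\<Prod>a\<in>J. if a \<in> A then 1 else k)"
      by (auto simp: card_PiE fin intro!: prod.cong)
    also have "\<dots> = (\<Prod>a\<in>J - A. k)"
      by (rule prod.mono_neutral_cong_right) (use fin in auto)
    also have "\<dots> = k ^ (?n - card A)"
      using A fin by (simp add: card_Diff_subset finite_subset)
    finally have "real (card {g \<in> G. A \<subseteq> S g}) = real k ^ (?n - card A)" by simp
    also have "\<dots> = real k ^ ?n / real k ^ card A"
      using k card_mono[OF fin(1) A] by (intro power_diff) auto
    finally show ?thesis .
  qed
  have swap: "(\<Sum>g\<in>G. real (card {x \<in> X. V x \<subseteq> S g})) = (\<Sum>x\<in>X. real (card {g \<in> G. V x \<subseteq> S g}))"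
    if "finite X" for X :: "'x set" and V
  proof -
    have "(\<Sum>g\<in>G. real (card {x \<in> X. V x \<subseteq> S g})) = (\<Sum>g\<in>G. \<Sum>x\<in>X. if V x \<subseteq> S g then 1 else 0)"
      using that by (simp add: sum.If_cases Int_def)
    also have "\<dots> = (\<Sum>x\<in>X. \<Sum>g\<in>G. if V x \<subseteq> S g then 1 else 0)"
      by (rule sum.swap)
    finally show ?thesis using finG by (simp add: sum.If_cases Int_def)
  qed
  have "(\<Sum>g\<in>G. real (card {e \<in> E. VE e \<subseteq> S g}))
      \<le> (\<Sum>g\<in>G. 3 * real (card {a \<in> J. {a} \<subseteq> S g}) + real (card {d \<in> D. VD d \<subseteq> S g}))"
  proof (rule sum_mono)
    fix g assume "g \<in> G"
    have "card {e \<in> E. VE e \<subseteq> S g} \<le> 3 * card (S g) + card {d \<in> D. VD d \<subseteq> S g}"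
      by (rule bound) (auto simp: S_def)
    moreover have "{a \<in> J. {a} \<subseteq> S g} = S g" by (auto simp: S_def)
    ultimately show "real (card {e \<in> E. VE e \<subseteq> S g})
        \<le> 3 * real (card {a \<in> J. {a} \<subseteq> S g}) + real (card {d \<in> D. VD d \<subseteq> S g})"
      by (metis (mono_tags, lifting) of_nat_add of_nat_le_iff of_nat_mult of_nat_numeral)
  qed
  also have "\<dots> = 3 * (\<Sum>g\<in>G. real (card {a \<in> J. {a} \<subseteq> S g})) + (\<Sum>g\<in>G. real (card {d \<in> D. VD d \<subseteq> S g}))"
    by (simp add: sum.distrib sum_distrib_left)
  finally have "(\<Sum>e\<in>E. real (card {g \<in> G. VE e \<subseteq> S g}))
      \<le> 3 * (\<Sum>a\<in>J. real (card {g \<in> G. {a} \<subseteq> S g})) + (\<Sum>d\<in>D. real (card {g \<in> G. VD d \<subseteq> S g}))"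
    by (simp only: swap fin)
  moreover have "(\<Sum>e\<in>E. real (card {g \<in> G. VE e \<subseteq> S g})) = (\<Sum>e\<in>E. real k ^ ?n / real k ^ 2)"
    by (rule sum.cong) (use VE count in auto)
  moreover have "(\<Sum>a\<in>J. real (card {g \<in> G. {a} \<subseteq> S g})) = (\<Sum>a\<in>J. real k ^ ?n / real k ^ 1)"
  proof (rule sum.cong)
    fix a assume "a \<in> J"
    then show "real (card {g \<in> G. {a} \<subseteq> S g}) = real k ^ ?n / real k ^ 1"
      using count[of "{a}"] by simp
  qed simp
  moreover have "(\<Sum>d\<in>D. real (card {g \<in> G. VD d \<subseteq> S g})) = (\<Sum>d\<in>D. real k ^ ?n / real k ^ 4)"
    by (rule sum.cong) (use VD count in auto)
  ultimately have main: "real (card E) * (real k ^ ?n / real k ^ 2) \<le>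
      3 * (real ?n * (real k ^ ?n / real k ^ 1)) + real (card D) * (real k ^ ?n / real k ^ 4)"
    by (simp only: sum_constant)
  have kpos: "real k > 0" using k by simp
  have "real (card E) * (real k ^ ?n / real k ^ 2) * (real k ^ 2 / real k ^ ?n) \<le>
      (3 * (real ?n * (real k ^ ?n / real k ^ 1)) + real (card D) * (real k ^ ?n / real k ^ 4)) * (real k ^ 2 / real k ^ ?n)"
    by (rule mult_right_mono[OF main]) simp
  also have "\<dots> = 3 * real ?n * real k + real (card D) / real k ^ 2"
    using kpos by (simp add: field_simps power2_eq_square power4_eq_xxxx)
  finally show ?thesis using kpos by simp
qed

lemma ex_arg_min:
  fixes g :: "'a \<Rightarrow> real"
  assumes "finite S" "S \<noteq> {}"
  shows "\<exists>x\<in>S. \<forall>y\<in>S. g x \<le> g y"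
  using arg_min_if_finite(1)[OF assms] arg_min_least[OF assms] by metis

section \<open>Diamond-free graphs have linearly many edges\<close>

context pencil
begin

lemma finite_J: "finite J"
  using J_sub finite_F finite_subset by auto

text \<open>A meaningful value only if \<open>a\<close> crosses \<open>b\<close>; for curves of
  \<open>F\<close> it is then unique by \<open>crosses_unique\<close>.\<close>

definition ctime :: "'a \<Rightarrow> 'a \<Rightarrow> real" where
  "ctime a b = (SOME s. crosses a b s)"

lemma ctime: "crosses a b s \<Longrightarrow> crosses a b (ctime a b)"
  unfolding ctime_def by (rule someI)

definition diamonds :: "('a \<times> 'a) set \<Rightarrow> (('a \<times> 'a) \<times> ('a \<times> 'a)) set" where
  "diamonds E = {(e, e') \<in> E \<times> E.
     diamond (fst e) (snd e) (ctime (fst e) (snd e)) (fst e') (snd e') (ctime (fst e') (snd e'))}"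

lemma cross_same_time:
  assumes "crosses a b s" "crosses a d s" "a \<in> J" "b \<in> J" "d \<in> J"
  shows "b = d"
  using assms no_triple_J[of a b d s] crosses_J[OF assms(1)] crosses_J[OF assms(2)]
    crosses_neq[OF assms(1)] crosses_neq[OF assms(2)] by auto

text \<open>While \<open>d\<close> is the next neighbour of \<open>a\<close> in the graph,
  \<open>z\<close> competes with all curves of \<open>J\<close> that cross \<open>a\<close> in
  between: \<open>wedge_diamond\<close> uses its minimality against curves that need not be
  neighbours.\<close>

definition wedge :: "('a \<times> 'a) set \<Rightarrow> 'a \<Rightarrow> 'a \<Rightarrow> 'a \<Rightarrow> 'a \<Rightarrow> real \<Rightarrow> bool" where
  "wedge E a b d z w \<longleftrightarrow> (a, d) \<in> E \<and> ctime a b < ctime a d \<and>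
    (\<forall>d'. (a, d') \<in> E \<longrightarrow> ctime a b < ctime a d' \<longrightarrow> ctime a d \<le> ctime a d') \<and>
    z \<in> J \<and> crosses a z w \<and> ctime a b \<le> w \<and> w \<le> ctime a d \<and>
    (\<forall>k v. k \<in> J \<longrightarrow> ctime a b \<le> v \<longrightarrow> v \<le> ctime a d \<longrightarrow> crosses a k v \<longrightarrow> f z c \<le> f k c)"

lemma wedge_exists:
  assumes E: "E \<subseteq> J \<times> J" and ab: "(a, b) \<in> E" "crosses a b (ctime a b)"
    and later: "\<exists>d. (a, d) \<in> E \<and> ctime a b < ctime a d"
  shows "\<exists>d z w. wedge E a b d z w"
proof -
  let ?L = "{d. (a, d) \<in> E \<and> ctime a b < ctime a d}"
  have "?L \<subseteq> J" using E by auto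
  then have "finite ?L" using finite_J finite_subset by blast
  then obtain d where d: "d \<in> ?L" "\<forall>y\<in>?L. ctime a d \<le> ctime a y"
    using ex_arg_min[of ?L "ctime a"] later by auto
  let ?K = "{k \<in> J. \<exists>v. ctime a b \<le> v \<and> v \<le> ctime a d \<and> crosses a k v}"
  have "finite ?K" "b \<in> ?K" using finite_J E ab d by auto
  then obtain z where "z \<in> ?K" "\<forall>y\<in>?K. f z c \<le> f y c"
    using ex_arg_min[of ?K "\<lambda>k. f k c"] by blast
  then show ?thesis unfolding wedge_def using d by blast
qed

text \<open>Order the crossings on each curve by time. A pair of consecutive ones bounds a wedge, which
  is charged to the initially lowest curve that passes through it; \<open>wedge_diamond\<close> makes these
  charges almost injective.\<close>

lemma card_no_diamonds:
  assumes E: "E \<subseteq> J \<times> J" and cr: "\<And>a b. (a, b) \<in> E \<Longrightarrow> \<exists>s. crosses a b s"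
    and nd: "diamonds E = {}"
  shows "card E \<le> 3 * card J"
proof -
  have cr: "\<And>a b. (a, b) \<in> E \<Longrightarrow> crosses a b (ctime a b)" using cr ctime by blast
  have finE: "finite E" using E finite_J finite_subset by blast
  \<comment> \<open>Edges that open a wedge. The remaining ones are the last edges at their curve
    \<open>a\<close>, at most one for each \<open>a\<close>, and take one of the three multiples of
    \<open>card J\<close>.\<close>
  define E1 where "E1 = {(a, b). (a, b) \<in> E \<and> (\<exists>d. (a, d) \<in> E \<and> ctime a b < ctime a d)}"
  have E1: "E1 \<subseteq> E" by (auto simp: E1_def)
  have "inj_on fst (E - E1)"
  proof (rule inj_onI)
    fix x y assume xy: "x \<in> E - E1" "y \<in> E - E1" "fst x = fst y"
    obtain a b b' where ab: "x = (a, b)" "y = (a, b')" using xy(3) by (metis prod.collapse)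
    have "ctime a b = ctime a b'" using xy ab by (force simp: E1_def)
    then show "x = y" using cross_same_time[of a b _ b'] cr[of a b] cr[of a b'] xy ab E by auto
  qed
  then have c0: "card (E - E1) \<le> card J"
    by (rule card_inj_on_le[OF _ _ finite_J]) (use E in auto)
  have "\<forall>e\<in>E1. \<exists>p. wedge E (fst e) (snd e) (fst p) (fst (snd p)) (snd (snd p))"
    using wedge_exists[OF E] cr by (fastforce simp: E1_def)
  then obtain p where p: "\<And>e. e \<in> E1 \<Longrightarrow> wedge E (fst e) (snd e) (fst (p e)) (fst (snd (p e))) (snd (snd (p e)))"
    by (metis bchoice)
  define D Z W where "D e = fst (p e)" and "Z e = fst (snd (p e))" and "W e = snd (snd (p e))" for e
  have w: "wedge E a b (D (a, b)) (Z (a, b)) (W (a, b))" if "(a, b) \<in> E1" for a b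
    using p[OF that] by (simp add: D_def Z_def W_def)
  note DZW = w[unfolded wedge_def, THEN conjunct1]
    w[unfolded wedge_def, THEN conjunct2, THEN conjunct1]
    w[unfolded wedge_def, THEN conjunct2, THEN conjunct2, THEN conjunct1, rule_format]
    w[unfolded wedge_def, THEN conjunct2, THEN conjunct2, THEN conjunct2, THEN conjunct1]
    w[unfolded wedge_def, THEN conjunct2, THEN conjunct2, THEN conjunct2, THEN conjunct2, THEN conjunct1]
    w[unfolded wedge_def, THEN conjunct2, THEN conjunct2, THEN conjunct2, THEN conjunct2, THEN conjunct2, THEN conjunct1]
    w[unfolded wedge_def, THEN conjunct2, THEN conjunct2, THEN conjunct2, THEN conjunct2, THEN conjunct2, THEN conjunct2, THEN conjunct1]
    w[unfolded wedge_def, THEN conjunct2, THEN conjunct2, THEN conjunct2, THEN conjunct2, THEN conjunct2, THEN conjunct2, THEN conjunct2, rule_format]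
  \<comment> \<open>The flag isolates the exceptional case of \<open>wedge_diamond\<close>. Each
    curve can thus be charged twice, which accounts for the remaining
    \<open>2 * card J\<close>.\<close>
  define ch where "ch e = (Z e, Z e = snd e)" for e
  \<comment> \<open>Two wedges at one \<open>a\<close> share at most a boundary, and
    \<open>z\<close> crosses \<open>a\<close> only once. So \<open>z\<close> crosses where the first
    wedge ends and the second begins, and the flags disagree.\<close>
  have same: False if e: "(a, b) \<in> E1" "(a, b') \<in> E1" "ch (a, b) = ch (a, b')" "ctime a b < ctime a b'" for a b b'
  proof -
    have z: "Z (a, b) = Z (a, b')" "Z (a, b) = b \<longleftrightarrow> Z (a, b') = b'" using e by (auto simp: ch_def)
    have J: "a \<in> J" "b \<in> J" "b' \<in> J" "Z (a, b) \<in> J" using e E1 E DZW by auto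
    have W: "W (a, b) = W (a, b')"
      using crosses_unique[of a "Z (a, b)"] DZW(5)[OF e(1)] DZW(5)[OF e(2)] z J J_sub by auto
    have "ctime a (D (a, b)) \<le> ctime a b'" using DZW(3)[OF e(1) _ e(4)] e E1 by auto
    then have wb': "W (a, b) = ctime a b'" using DZW(7)[OF e(1)] DZW(6)[OF e(2)] W by auto
    then have "Z (a, b') = b'"
      using cross_same_time[OF _ cr[of a b']] DZW(5)[OF e(2)] z e E1 J W by auto
    then have "Z (a, b) = b" using z by auto
    then have "W (a, b) = ctime a b"
      using crosses_unique[of a b] DZW(5)[OF e(1)] cr[of a b] e E1 J J_sub by auto
    then show False using wb' e(4) by simp
  qed
  have diff: False if e: "(a, b) \<in> E1" "(a', b') \<in> E1" "ch (a, b) = ch (a', b')" "W (a, b) < W (a', b')" for a b a' b'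
  proof -
    have z: "Z (a, b) = Z (a', b')" "Z (a, b) = b \<longleftrightarrow> Z (a', b') = b'" using e by (auto simp: ch_def)
    have ee: "(a, b) \<in> E" "(a', b') \<in> E" using e E1 by auto
    note d = DZW(1)[OF e(1)] DZW(1)[OF e(2)]
    have J: "a \<in> J" "b \<in> J" "D (a, b) \<in> J" "a' \<in> J" "b' \<in> J" "D (a', b') \<in> J" "Z (a, b) \<in> J"
      using ee d E DZW(4)[OF e(1)] by auto
    \<comment> \<open>Only the exceptional case of \<open>wedge_diamond\<close> survives. There the
      first flag is true; the second one then puts \<open>W (a', b')\<close> at the beginning of its
      wedge, although it lies at the end.\<close>
    have "W (a, b) = ctime a b \<and> W (a', b') = ctime a' (D (a', b'))"
    proof (rule ccontr)
      assume nb: "\<not> ?thesis"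
      have "diamond a b (ctime a b) a' (D (a', b')) (ctime a' (D (a', b')))"
        by (rule wedge_diamond[OF J cr[OF ee(1)] cr[OF d(1)] DZW(2)[OF e(1)] cr[OF ee(2)] cr[OF d(2)] DZW(2)[OF e(2)]
          DZW(5)[OF e(1)] DZW(6)[OF e(1)] DZW(7)[OF e(1)] _ DZW(6)[OF e(2)] DZW(7)[OF e(2)] e(4)
          DZW(8)[OF e(1)] _ nb])
          (use z DZW(5)[OF e(2)] DZW(8)[OF e(2)] in auto)
      then have "((a, b), (a', D (a', b'))) \<in> diamonds E"
        using ee d by (auto simp: diamonds_def)
      then show False using nd by auto
    qed
    then have w: "W (a, b) = ctime a b" "W (a', b') = ctime a' (D (a', b'))" by auto
    have "Z (a, b) = b"
      using cross_same_time[OF _ cr[OF ee(1)]] DZW(5)[OF e(1)] w J by auto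
    then have "Z (a', b') = b'" using z by auto
    then have "W (a', b') = ctime a' b'"
      using crosses_unique[of a' b'] DZW(5)[OF e(2)] cr[OF ee(2)] J J_sub by auto
    then show False using w DZW(2)[OF e(2)] by simp
  qed
  have "inj_on ch E1"
  proof (rule inj_onI)
    fix x y assume xy: "x \<in> E1" "y \<in> E1" "ch x = ch y"
    obtain a b a' b' where [simp]: "x = (a, b)" "y = (a', b')" by fastforce
    have J: "a \<in> J" "b \<in> J" "a' \<in> J" "b' \<in> J" "Z (a, b) \<in> J" using xy E1 E DZW(4)[of a b] by auto
    show "x = y"
    proof (cases "a = a'")
      case True
      then have "\<not> ctime a b < ctime a b'" "\<not> ctime a b' < ctime a b"
        using same[of a b b'] same[of a b' b] xy by auto
      then have "ctime a b = ctime a b'" by simp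
      then show ?thesis
        using cross_same_time[of a b "ctime a b" b'] cr[of a b] cr[of a b'] xy E1 True J by auto
    next
      case False
      have "\<not> W (a, b) < W (a', b')" "\<not> W (a', b') < W (a, b)"
        using diff[of a b a' b'] diff[of a' b' a b] xy by auto
      then have w: "W (a, b) = W (a', b')" by simp
      have z: "Z (a, b) = Z (a', b')" using xy by (simp add: ch_def)
      have 1: "crosses a (Z (a, b)) (W (a, b))" using DZW(5)[of a b] xy by simp
      have 2: "crosses a' (Z (a, b)) (W (a, b))" using DZW(5)[of a' b'] xy w z by simp
      from no_triple_J[of a a' "Z (a, b)" "W (a, b)"] show ?thesis
        using J False crosses_neq[OF 1] crosses_neq[OF 2] crosses_J(1,2,3)[OF 1 J(1,5)]
          crosses_J(3)[OF 2 J(3,5)] by simp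
    qed
  qed
  then have "card E1 \<le> card (J \<times> (UNIV :: bool set))"
    by (rule card_inj_on_le) (use DZW(4) finite_J in \<open>auto simp: ch_def\<close>)
  then have "card E1 \<le> 2 * card J" by (simp add: card_cartesian_product)
  moreover have "card E = card (E - E1) + card E1"
    using card_Diff_subset[OF finite_subset[OF E1 finE] E1] card_mono[OF finE E1] by simp
  ultimately show ?thesis using c0 by simp
qed

lemma finite_diamonds: "finite E \<Longrightarrow> finite (diamonds E)"
  unfolding diamonds_def by (rule finite_subset[of _ "E \<times> E"]) auto

text \<open>Deleting the first edge of every diamond destroys all diamonds.\<close>

lemma card_le_diamonds:
  assumes E: "E \<subseteq> J \<times> J" and cr: "\<And>a b. (a, b) \<in> E \<Longrightarrow> \<exists>s. crosses a b s"
  shows "card E \<le> 3 * card J + card (diamonds E)"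
proof -
  have finE: "finite E" using E finite_J finite_subset by blast
  let ?E = "E - fst ` diamonds E"
  have "diamonds ?E = {}" unfolding diamonds_def by force
  then have "card ?E \<le> 3 * card J" using card_no_diamonds[of ?E] E cr by blast
  moreover have "card E \<le> card (?E \<union> fst ` diamonds E)"
    by (rule card_mono) (use finE finite_diamonds in auto)
  moreover have "\<dots> \<le> card ?E + card (fst ` diamonds E)"
    by (rule card_Un_le)
  moreover have "card (fst ` diamonds E) \<le> card (diamonds E)"
    by (intro card_image_le finite_diamonds finE)
  ultimately show ?thesis by linarith
qed

end

lemma (in pencil) pencil_subset: "S \<subseteq> J \<Longrightarrow> pencil F f c r S \<mu>"
  by unfold_locales (use J_sub r_J in auto)

text \<open>Every sample is itself a pencil, so the linear bound applies to it. The strict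
  inequalities make the four curves of a diamond distinct, hence a diamond survives with probability
  \<open>1 / k ^ 4\<close> only.\<close>

lemma (in pencil) card_sampled:
  assumes E: "E \<subseteq> J \<times> J" and cr: "\<And>a b. (a, b) \<in> E \<Longrightarrow> \<exists>s. crosses a b s" and k: "k \<ge> (1::nat)"
  shows "real (card E) \<le> 3 * real (card J) * real k + real (card (diamonds E)) / real k ^ 2"
proof (rule sampling_bound[where VE = "\<lambda>e. {fst e, snd e}" and VD = "\<lambda>d. {fst (fst d), snd (fst d), fst (snd d), snd (snd d)}"])
  show finE: "finite J" "finite E" "finite (diamonds E)"
    using E finite_J finite_subset finite_diamonds by blast+
  show "k \<ge> 1" by fact
  show "{fst e, snd e} \<subseteq> J \<and> card {fst e, snd e} = 2" if "e \<in> E" for e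
    using that E cr[of "fst e" "snd e"] crosses_neq by auto
  show "{fst (fst d), snd (fst d), fst (snd d), snd (snd d)} \<subseteq> J \<and>
      card {fst (fst d), snd (fst d), fst (snd d), snd (snd d)} = 4" if d: "d \<in> diamonds E" for d
  proof -
    obtain a b a' b' where [simp]: "d = ((a, b), (a', b'))" by (metis prod.collapse)
    have e: "(a, b) \<in> E" "(a', b') \<in> E" and dia: "diamond a b (ctime a b) a' b' (ctime a' b')"
      using d by (auto simp: diamonds_def)
    have cr2: "crosses a b (ctime a b)" "crosses a' b' (ctime a' b')" using cr e ctime by blast+
    have J: "a \<in> J" "b \<in> J" "a' \<in> J" "b' \<in> J" using e E by auto
    have "a \<noteq> b" "a' \<noteq> b'" using cr2 crosses_neq by auto
    moreover have "a' \<noteq> a" "a' \<noteq> b" "b' \<noteq> a" "b' \<noteq> b"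
      using dia crosses_J(3)[OF cr2(1)] J by (auto simp: diamond_def)
    ultimately show ?thesis using J by auto
  qed
  show "card {e \<in> E. {fst e, snd e} \<subseteq> S} \<le> 3 * card S +
      card {d \<in> diamonds E. {fst (fst d), snd (fst d), fst (snd d), snd (snd d)} \<subseteq> S}" if S: "S \<subseteq> J" for S
  proof -
    let ?E = "{e \<in> E. {fst e, snd e} \<subseteq> S}"
    interpret S: pencil F f c r S \<mu> by (rule pencil_subset[OF S])
    have "card ?E \<le> 3 * card S + card (S.diamonds ?E)"
      by (rule S.card_le_diamonds) (use cr in auto)
    moreover have "S.diamonds ?E \<subseteq> {d \<in> diamonds E. {fst (fst d), snd (fst d), fst (snd d), snd (snd d)} \<subseteq> S}"
      by (auto simp: S.diamonds_def diamonds_def)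
    then have "card (S.diamonds ?E) \<le> card {d \<in> diamonds E. {fst (fst d), snd (fst d), fst (snd d), snd (snd d)} \<subseteq> S}"
      by (intro card_mono) (use finE in auto)
    ultimately show ?thesis by linarith
  qed
qed

section \<open>Curves touching a pencil from below\<close>

lemma ex_less_all_others:
  fixes A :: "real set"
  assumes "card A = Suc n"
  shows "\<exists>x\<in>A. card (A - {x}) = n \<and> (\<forall>y\<in>A - {x}. x < y)"
proof -
  have fin: "finite A" "A \<noteq> {}" using assms card.infinite by force+
  then have "Min A \<in> A" by simp
  then show ?thesis
    using assms fin by (intro bexI[of _ "Min A"]) (auto simp: order_less_le)
qed

locale touching = pencil +
  fixes L :: "'a set" and P :: "('a \<times> 'a) set" and tt :: "'a \<Rightarrow> 'a \<Rightarrow> real"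
  assumes L_sub: "L \<subseteq> F" and disj: "L \<inter> J = {}" and r_L: "i \<in> L \<Longrightarrow> r i \<le> \<mu>"
    and P_sub: "P \<subseteq> L \<times> J"
    and touch: "(i, a) \<in> P \<Longrightarrow> c \<le> tt i a \<and> tt i a \<le> r i \<and> f i (tt i a) = f a (tt i a)"
    and below: "(i, a) \<in> P \<Longrightarrow> c \<le> t \<Longrightarrow> t \<le> r i \<Longrightarrow> f i t \<le> f a t"
begin

lemma PF:
  assumes "(i, a) \<in> P"
  shows "i \<in> F" "a \<in> F" "a \<in> J" "i \<in> L" "i \<noteq> a" "r a = \<mu>" "r i \<le> \<mu>" "c \<le> tt i a" "tt i a \<le> r i"
    "tt i a \<le> \<mu>"
  using assms P_sub L_sub J_sub disj r_L r_J touch[OF assms] by (auto, force)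

lemma touch_below:
  assumes "(i, a) \<in> P" "(i, b) \<in> P" "a \<noteq> b"
  shows "f a (tt i a) < f b (tt i a)"
proof -
  have "f a (tt i a) \<le> f b (tt i a)"
    using below[OF assms(2), of "tt i a"] touch[OF assms(1)] by auto
  moreover have "f a (tt i a) \<noteq> f b (tt i a)"
    using no_triple[of i a b "tt i a"] PF[OF assms(1)] PF[OF assms(2)] touch[OF assms(1)] assms(3) by auto
  ultimately show ?thesis by simp
qed

lemma tt_inj: "(i, a) \<in> P \<Longrightarrow> (i, b) \<in> P \<Longrightarrow> tt i a = tt i b \<Longrightarrow> a = b"
  using touch_below[of i a b] touch_below[of i b a] by (cases "a = b") auto

text \<open>By \<open>touch_below\<close>, the curve being touched is strictly the lower of the two
  at either touch.\<close>

lemma touch_order: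
  assumes "(i, a) \<in> P" "(i, b) \<in> P" "tt i a < tt i b"
  shows "\<exists>s. tt i a < s \<and> s < tt i b \<and> crosses a b s"
proof -
  have "a \<noteq> b" using assms(3) by auto
  then show ?thesis
    using crossesI[of a b "tt i a" "tt i b"] touch_below[OF assms(1,2)] touch_below[OF assms(2,1)]
      PF[OF assms(1)] PF[OF assms(2)] assms(3) by auto
qed

lemma order_before:
  assumes "(i, a) \<in> P" "(i, b) \<in> P" "tt i a \<le> tt i b" "c \<le> u" "u \<le> tt i a"
  shows "f a u \<le> f b u"
proof (cases "a = b")
  case False
  then have "tt i a < tt i b" using tt_inj assms by force
  then obtain s where s: "tt i a < s" "crosses a b s" using touch_order assms by blast
  then show ?thesis using crosses_J(4)[OF s(2), of u] PF[OF assms(1)] PF[OF assms(2)] assms by auto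
qed auto

lemma order_after:
  assumes "(i, a) \<in> P" "(i, b) \<in> P" "tt i a \<le> tt i b" "tt i b \<le> u" "u \<le> \<mu>"
  shows "f b u \<le> f a u"
proof (cases "a = b")
  case False
  then have "tt i a < tt i b" using tt_inj assms by force
  then obtain s where s: "s < tt i b" "crosses a b s" using touch_order assms by blast
  then show ?thesis using crosses_J(5)[OF s(2), of u] PF[OF assms(1)] PF[OF assms(2)] assms by auto
qed auto

definition consec :: "'a \<Rightarrow> 'a \<Rightarrow> 'a \<Rightarrow> bool" where
  "consec i a b \<longleftrightarrow> (i, a) \<in> P \<and> (i, b) \<in> P \<and> tt i a < tt i b \<and>
     (\<forall>j. (i, j) \<in> P \<longrightarrow> tt i j \<le> tt i a \<or> tt i b \<le> tt i j)"

lemma consecD: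
  assumes "consec i a b"
  shows "(i, a) \<in> P" "(i, b) \<in> P" "tt i a < tt i b"
    and "\<And>j. (i, j) \<in> P \<Longrightarrow> tt i j \<le> tt i a \<or> tt i b \<le> tt i j"
  using assms by (auto simp: consec_def)

lemma consec_ctime:
  assumes "consec i a b"
  shows "crosses a b (ctime a b)" "tt i a < ctime a b" "ctime a b < tt i b"
proof -
  note D = consecD[OF assms]
  obtain s where s: "tt i a < s" "s < tt i b" "crosses a b s"
    using touch_order[OF D(1,2,3)] by blast
  have "ctime a b = s"
    using crosses_unique[OF _ _ ctime[OF s(3)] s(3)] PF[OF D(1)] PF[OF D(2)] by auto
  then show "crosses a b (ctime a b)" "tt i a < ctime a b" "ctime a b < tt i b" using s by auto
qed

lemma consec_J:
  assumes "consec i a b"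
  shows "c < ctime a b" "ctime a b < r i" "ctime a b \<le> \<mu>" "f a (ctime a b) = f b (ctime a b)"
  using consec_ctime[OF assms] consecD[OF assms] PF[of i a] PF[of i b]
    crosses_J[OF consec_ctime(1)[OF assms]] by auto

lemma consec_less:
  assumes "consec i a b" "consec i a2 b2" "ctime a b < ctime a2 b2"
  shows "tt i b \<le> tt i a2"
proof (rule ccontr)
  assume "\<not> tt i b \<le> tt i a2"
  note A = consecD[OF assms(1)] and B = consecD[OF assms(2)]
    and C = consec_ctime[OF assms(1)] and D = consec_ctime[OF assms(2)]
  have "tt i a2 \<le> tt i a" using A(4)[OF B(1)] \<open>\<not> _\<close> by auto
  moreover have "tt i b2 > tt i a" using C D assms(3) by auto
  ultimately have "tt i a2 = tt i a" "tt i b2 = tt i b"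
    using A(4)[OF B(2)] B(4)[OF A(1)] B(4)[OF A(2)] A(3) by auto
  then have "a2 = a" "b2 = b" using tt_inj A B by auto
  then show False using assms(3) by simp
qed

lemma consec_eq:
  assumes "consec i a b" "consec i a2 b2" "ctime a b = ctime a2 b2"
  shows "a = a2 \<and> b = b2"
proof -
  note A = consecD[OF assms(1)] and B = consecD[OF assms(2)]
    and C = consec_ctime[OF assms(1)] and D = consec_ctime[OF assms(2)]
  have "tt i a2 = tt i a" "tt i b2 = tt i b"
    using A(4)[OF B(1)] A(4)[OF B(2)] B(4)[OF A(1)] B(4)[OF A(2)] C D assms(3) by auto
  then show ?thesis using tt_inj A B by auto
qed

text \<open>A curve touched no later than \<open>a\<close> is above \<open>a\<close> by
  \<open>order_after\<close>. Any other one is touched no earlier than \<open>b\<close> and is above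
  \<open>b\<close> by \<open>order_before\<close>, and \<open>b\<close> meets \<open>a\<close> at
  this time.\<close>

lemma envelope:
  assumes "consec i a b" "(i, j) \<in> P"
  shows "f a (ctime a b) \<le> f j (ctime a b)"
proof (cases "tt i j \<le> tt i a")
  case True
  then show ?thesis
    using order_after[OF assms(2) consecD(1)[OF assms(1)], of "ctime a b"] consec_ctime[OF assms(1)]
      consec_J[OF assms(1)] by auto
next
  case False
  then show ?thesis
    using order_before[OF consecD(2)[OF assms(1)] assms(2), of "ctime a b"] consec_ctime[OF assms(1)]
      consec_J[OF assms(1)] consecD(4)[OF assms] by auto
qed

text \<open>The curves touched by \<open>i\<close> have a lower envelope above \<open>i\<close> with the crossings of consecutive
  pairs as its vertices. A linked pair plays the role of a common upper tangent of the envelopes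
  of \<open>i\<close> and \<open>i'\<close>; many of them would force \<open>i\<close> and \<open>i'\<close> to cross repeatedly.\<close>

definition linked :: "'a \<Rightarrow> 'a \<Rightarrow> 'a \<times> 'a \<Rightarrow> 'a \<times> 'a \<Rightarrow> bool" where
  "linked i i' e e' \<longleftrightarrow> consec i (fst e) (snd e) \<and> consec i' (fst e') (snd e') \<and>
     diamond (fst e) (snd e) (ctime (fst e) (snd e)) (fst e') (snd e') (ctime (fst e') (snd e'))"

lemma linkedD:
  assumes "linked i i' (a, b) (a', d)"
  shows "consec i a b" "consec i' a' d" "ctime a b < ctime a' d"
    "f a' (ctime a b) < f a (ctime a b)" "f a (ctime a b) < f d (ctime a b)"
    "f b (ctime a' d) < f a' (ctime a' d)" "f a' (ctime a' d) < f a (ctime a' d)"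
  using assms by (auto simp: linked_def diamond_def)

lemma not_linked_self: "\<not> linked i i (a, b) (a', d)"
proof
  assume l: "linked i i (a, b) (a', d)"
  then show False
    using envelope[OF linkedD(1)[OF l] consecD(1)[OF linkedD(2)[OF l]]] linkedD[OF l] by auto
qed

text \<open>When \<open>a\<close> crosses \<open>b\<close>, the earlier partner has
  \<open>d1\<close> above \<open>a\<close> and the later one has \<open>a2\<close> below
  \<open>a\<close>. But \<open>i'\<close> touches \<open>d1\<close> no later than \<open>a2\<close>,
  so \<open>d1\<close> cannot be the higher one that early.\<close>

lemma linked_right_unique:
  assumes l: "linked i i' (a, b) (a1, d1)" "linked i i' (a, b) (a2, d2)"
  shows "\<not> ctime a1 d1 < ctime a2 d2"
proof
  assume less: "ctime a1 d1 < ctime a2 d2"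
  note A = linkedD[OF l(1)] and B = linkedD[OF l(2)]
  have "tt i' d1 \<le> tt i' a2" by (rule consec_less[OF A(2) B(2) less])
  then have "f d1 (ctime a b) \<le> f a2 (ctime a b)"
    using order_before[OF consecD(2)[OF A(2)] consecD(1)[OF B(2)], of "ctime a b"]
      consec_J[OF A(1)] consec_ctime[OF A(2)] A(3) by auto
  then show False using A(5) B(4) by simp
qed

lemma linked_left_unique:
  assumes l: "linked i i' (a1, b1) (a', d)" "linked i i' (a2, b2) (a', d)"
  shows "\<not> ctime a1 b1 < ctime a2 b2"
proof
  assume less: "ctime a1 b1 < ctime a2 b2"
  note A = linkedD[OF l(1)] and B = linkedD[OF l(2)]
  have "tt i b1 \<le> tt i a2" by (rule consec_less[OF A(1) B(1) less])
  then have "f a2 (ctime a' d) \<le> f b1 (ctime a' d)"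
    using order_after[OF consecD(2)[OF A(1)] consecD(1)[OF B(1)], of "ctime a' d"]
      consec_J[OF B(2)] consec_ctime[OF B(1)] B(3) by auto
  then show False using A(6) B(7) by simp
qed

text \<open>In the reverse order \<open>d2\<close> and \<open>a2\<close> would swap twice:
  \<open>d2\<close> is not above \<open>a2\<close> at \<open>ctime a1 b1\<close>, above it at
  \<open>ctime a2 b2\<close>, and below it at \<open>ctime a2' d2\<close>.\<close>

lemma linked_monotone:
  assumes l: "linked i i' (a1, b1) (a1', d1)" "linked i i' (a2, b2) (a2', d2)"
    and less: "ctime a1 b1 < ctime a2 b2"
  shows "ctime a1' d1 < ctime a2' d2"
proof (rule ccontr)
  assume neg: "\<not> ?thesis"
  note A = linkedD[OF l(1)] and B = linkedD[OF l(2)]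
  have ne: "ctime a1' d1 \<noteq> ctime a2' d2"
    using consec_eq[OF A(2) B(2)] linked_left_unique[of i i' a1 b1 a1' d1 a2 b2] l less by auto
  then have gt: "ctime a2' d2 < ctime a1' d1" using neg by simp
  have "tt i' d2 \<le> tt i' a1'" by (rule consec_less[OF B(2) A(2) gt])
  then have "f d2 (ctime a1 b1) \<le> f a1' (ctime a1 b1)"
    using order_before[OF consecD(2)[OF B(2)] consecD(1)[OF A(2)], of "ctime a1 b1"]
      consec_J[OF A(1)] consec_ctime[OF B(2)] less B(3) by auto
  moreover have "f a1 (ctime a1 b1) \<le> f a2 (ctime a1 b1)"
    by (rule envelope[OF A(1) consecD(1)[OF B(1)]])
  ultimately have "f d2 (ctime a1 b1) \<le> f a2 (ctime a1 b1)" using A(4) by simp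
  moreover have "f d2 (ctime a2' d2) \<le> f a2 (ctime a2' d2)"
    using B(7) consec_J(4)[OF B(2)] by simp
  ultimately show False
    using no_double_swap[of d2 a2 "ctime a1 b1" "ctime a2 b2" "ctime a2' d2"] less B(3,5)
      PF[OF consecD(2)[OF B(2)]] PF[OF consecD(1)[OF B(1)]] consec_J[OF A(1)] consec_J[OF B(2)] by auto
qed

text \<open>With overlapping time spans \<open>b1\<close> and \<open>d1\<close> would swap twice: at
  \<open>ctime a2 b2\<close> the chain \<open>d1\<close>, \<open>a2'\<close>, \<open>a2\<close>,
  \<open>b1\<close> is ascending, whereas \<open>d1\<close> is above \<open>b1\<close> at
  \<open>ctime a1 b1\<close> and at \<open>ctime a1' d1\<close>.\<close>

lemma linked_disjoint:
  assumes l: "linked i i' (a1, b1) (a1', d1)" "linked i i' (a2, b2) (a2', d2)"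
    and less: "ctime a1 b1 < ctime a2 b2"
  shows "ctime a1' d1 \<le> ctime a2 b2"
proof (rule ccontr)
  assume neg: "\<not> ?thesis"
  note A = linkedD[OF l(1)] and B = linkedD[OF l(2)]
  have "tt i' d1 \<le> tt i' a2'" by (rule consec_less[OF A(2) B(2) linked_monotone[OF l less]])
  then have "f d1 (ctime a2 b2) \<le> f a2' (ctime a2 b2)"
    using order_before[OF consecD(2)[OF A(2)] consecD(1)[OF B(2)], of "ctime a2 b2"]
      consec_J[OF B(1)] consec_ctime[OF A(2)] neg by auto
  moreover have "f a2 (ctime a2 b2) \<le> f b1 (ctime a2 b2)"
    by (rule envelope[OF B(1) consecD(2)[OF A(1)]])
  ultimately have "f d1 (ctime a2 b2) < f b1 (ctime a2 b2)" using B(4) by simp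
  moreover have "f b1 (ctime a1 b1) \<le> f d1 (ctime a1 b1)" "f b1 (ctime a1' d1) \<le> f d1 (ctime a1' d1)"
    using A(5,6) consec_J(4)[OF A(1)] consec_J(4)[OF A(2)] by auto
  ultimately show False
    using no_double_swap[of b1 d1 "ctime a1 b1" "ctime a2 b2" "ctime a1' d1"] less neg
      PF[OF consecD(2)[OF A(2)]] PF[OF consecD(2)[OF A(1)]] consec_J[OF A(1)] consec_J[OF A(2)] by auto
qed

text \<open>At both crossings on the envelope of \<open>i\<close> the curve \<open>i'\<close> lies
  below \<open>b1\<close>. If it were not below \<open>i\<close> where \<open>i\<close> touches
  \<open>b1\<close>, it would protrude above \<open>b1\<close> in between.\<close>

lemma linked_below_left:
  assumes l: "linked i i' (a1, b1) (a1', d1)" "linked i i' (a2, b2) (a2', d2)"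
    and less: "ctime a1 b1 < ctime a2 b2"
  shows "f i' (tt i b1) < f i (tt i b1)"
proof (rule ccontr)
  assume neg: "\<not> ?thesis"
  note A = linkedD[OF l(1)] and B = linkedD[OF l(2)]
  note P = PF[OF consecD(2)[OF A(1)]] PF[OF consecD(1)[OF A(2)]] PF[OF consecD(2)[OF B(2)]]
  have "tt i b1 \<le> tt i a2" by (rule consec_less[OF A(1) B(1) less])
  then have x: "ctime a1 b1 < tt i b1" "tt i b1 < ctime a2 b2" "ctime a2 b2 < r i'"
    using consec_ctime[OF A(1)] consec_ctime[OF B(1)] B(3) consec_J[OF B(2)] by auto
  have ii': "i \<noteq> i'" using not_linked_self l by blast
  have "f b1 (tt i b1) \<le> f i' (tt i b1)"
    using neg touch[OF consecD(2)[OF A(1)]] by auto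
  moreover have "f b1 (tt i b1) \<noteq> f i' (tt i b1)"
    using no_triple[of i b1 i' "tt i b1"] P ii' touch[OF consecD(2)[OF A(1)]] disj x by auto
  ultimately have "f b1 (tt i b1) < f i' (tt i b1)" by simp
  moreover have "f i' (ctime a1 b1) \<le> f b1 (ctime a1 b1)"
    using below[OF consecD(1)[OF A(2)], of "ctime a1 b1"] A(4) consec_J[OF A(1)] x by auto
  moreover have "f i' (ctime a2 b2) \<le> f b1 (ctime a2 b2)"
    using below[OF consecD(1)[OF B(2)], of "ctime a2 b2"] B(4) consec_J[OF B(1)] x
      envelope[OF B(1) consecD(2)[OF A(1)]] by auto
  ultimately show False
    using no_double_swap[of i' b1 "ctime a1 b1" "tt i b1" "ctime a2 b2"] P x consec_J[OF A(1)] consec_J[OF B(1)] by auto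
qed

text \<open>The mirror image of \<open>linked_below_left\<close>. Survival must be assumed here:
  \<open>i'\<close> outlives its own crossings, but \<open>i\<close> may die before the later
  crossing \<open>ctime a2' d2\<close>.\<close>

lemma linked_below_right:
  assumes l: "linked i i' (a1, b1) (a1', d1)" "linked i i' (a2, b2) (a2', d2)"
    and less: "ctime a1 b1 < ctime a2 b2" and alive: "ctime a2' d2 \<le> r i"
  shows "f i (tt i' a2') < f i' (tt i' a2')"
proof (rule ccontr)
  assume neg: "\<not> ?thesis"
  note A = linkedD[OF l(1)] and B = linkedD[OF l(2)]
  note P = PF[OF consecD(2)[OF A(1)]] PF[OF consecD(1)[OF B(2)]] PF[OF consecD(2)[OF B(1)]]
  have mono: "ctime a1' d1 < ctime a2' d2" by (rule linked_monotone[OF l less])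
  have "tt i' d1 \<le> tt i' a2'" by (rule consec_less[OF A(2) B(2) mono])
  then have x: "ctime a1' d1 < tt i' a2'" "tt i' a2' < ctime a2' d2"
    using consec_ctime[OF A(2)] consec_ctime[OF B(2)] by auto
  have ii': "i \<noteq> i'" using not_linked_self l by blast
  have "f a2' (tt i' a2') \<le> f i (tt i' a2')"
    using neg touch[OF consecD(1)[OF B(2)]] by auto
  moreover have "f a2' (tt i' a2') \<noteq> f i (tt i' a2')"
    using no_triple[of i' a2' i "tt i' a2'"] P ii' touch[OF consecD(1)[OF B(2)]] disj x alive by auto
  ultimately have "f a2' (tt i' a2') < f i (tt i' a2')" by simp
  moreover have "f i (ctime a1' d1) \<le> f a2' (ctime a1' d1)"
    using below[OF consecD(2)[OF A(1)], of "ctime a1' d1"] A(6) consec_J[OF A(2)] x alive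
      envelope[OF A(2) consecD(1)[OF B(2)]] by auto
  moreover have "f i (ctime a2' d2) \<le> f a2' (ctime a2' d2)"
    using below[OF consecD(2)[OF B(1)], of "ctime a2' d2"] B(6) consec_J[OF B(2)] alive by auto
  ultimately show False
    using no_double_swap[of i a2' "ctime a1' d1" "tt i' a2'" "ctime a2' d2"] P x alive
      consec_J[OF A(2)] consec_J[OF B(2)] by auto
qed

text \<open>Links 1 and 2 give a time with \<open>i'\<close> below \<open>i\<close>, links 2 and 3 a
  later one with \<open>i\<close> below \<open>i'\<close>, links 4 and 5 again one with
  \<open>i'\<close> below \<open>i\<close>. Link 4 begins after link 3 has ended, so it also shows
  that \<open>i\<close> is still alive where \<open>linked_below_right\<close> needs it.\<close>

lemma no_five_linked:
  assumes l: "linked i i' (a1, b1) (a1', d1)" "linked i i' (a2, b2) (a2', d2)"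
      "linked i i' (a3, b3) (a3', d3)" "linked i i' (a4, b4) (a4', d4)" "linked i i' (a5, b5) (a5', d5)"
    and less: "ctime a1 b1 < ctime a2 b2" "ctime a2 b2 < ctime a3 b3" "ctime a3 b3 < ctime a4 b4"
      "ctime a4 b4 < ctime a5 b5"
  shows False
proof -
  note B = linkedD[OF l(2)] and C = linkedD[OF l(3)] and D = linkedD[OF l(4)] and E = linkedD[OF l(5)]
    and A = linkedD[OF l(1)]
  have t3: "ctime a3' d3 \<le> ctime a4 b4" by (rule linked_disjoint[OF l(3,4) less(3)])
  have 1: "f i' (tt i b1) \<le> f i (tt i b1)"
    using linked_below_left[OF l(1,2) less(1)] by simp
  have 2: "f i (tt i' a3') < f i' (tt i' a3')"
    by (rule linked_below_right[OF l(2,3) less(2)]) (use t3 consec_J[OF D(1)] in auto)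
  have 3: "f i' (tt i b4) \<le> f i (tt i b4)"
    using linked_below_left[OF l(4,5) less(4)] by simp
  have "tt i b1 < ctime a2 b2"
    using consec_less[OF A(1) B(1) less(1)] consec_ctime[OF B(1)] by simp
  moreover have "ctime a2' d2 < tt i' a3'"
    using consec_less[OF B(2) C(2) linked_monotone[OF l(2,3) less(2)]] consec_ctime[OF B(2)] by simp
  ultimately have o1: "tt i b1 < tt i' a3'" using B(3) by simp
  have o2: "tt i' a3' < tt i b4" using consec_ctime[OF C(2)] t3 consec_ctime[OF D(1)] by simp
  have "tt i b4 < ctime a5 b5"
    using consec_less[OF D(1) E(1) less(4)] consec_ctime[OF E(1)] by simp
  then have "tt i b4 \<le> r i'" using E(3) consec_J[OF E(2)] by simp
  then show False
    using no_double_swap[of i' i "tt i b1" "tt i' a3'" "tt i b4"] 1 2 3 o1 o2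
      PF[OF consecD(2)[OF A(1)]] PF[OF consecD(2)[OF D(1)]] PF[OF consecD(1)[OF C(2)]] by auto
qed

lemma finite_P: "finite P"
  using P_sub L_sub finite_F finite_J finite_subset by (metis finite_SigmaI)

lemma card_linked: "card {(e, e'). linked i i' e e'} \<le> 4"
proof (rule ccontr)
  let ?D = "{(e, e'). linked i i' e e'}"
  let ?g = "\<lambda>x. ctime (fst (fst x)) (snd (fst x))"
  assume "\<not> ?thesis"
  then have five: "card ?D \<ge> 5" by simp
  have "inj_on ?g ?D"
  proof (rule inj_onI)
    fix x y assume xy: "x \<in> ?D" "y \<in> ?D" "?g x = ?g y"
    obtain a b a1 d1 where x: "x = ((a, b), (a1, d1))" by (metis prod.collapse)
    obtain a2' b2 a2 d2 where y: "y = ((a2', b2), (a2, d2))" by (metis prod.collapse)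
    have l: "linked i i' (a, b) (a1, d1)" "linked i i' (a2', b2) (a2, d2)" using xy x y by auto
    have eq: "a = a2'" "b = b2" using consec_eq[OF linkedD(1)[OF l(1)] linkedD(1)[OF l(2)]] xy x y by auto
    have "ctime a1 d1 = ctime a2 d2"
      using linked_right_unique[of i i' a b a1 d1 a2 d2] linked_right_unique[of i i' a b a2 d2 a1 d1] l eq by auto
    then show "x = y" using consec_eq[OF linkedD(2)[OF l(1)] linkedD(2)[OF l(2)]] x y eq by auto
  qed
  then have "card (?g ` ?D) \<ge> 5" using five by (simp add: card_image)
  then obtain S where S: "S \<subseteq> ?g ` ?D" "card S = 5"
    by (meson obtain_subset_with_card_n)
  obtain s1 where s1: "s1 \<in> S" "card (S - {s1}) = 4" "\<forall>y\<in>S - {s1}. s1 < y"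
    using ex_less_all_others[of S 4] S by auto
  obtain s2 where s2: "s2 \<in> S - {s1}" "card (S - {s1} - {s2}) = 3" "\<forall>y\<in>S - {s1} - {s2}. s2 < y"
    using ex_less_all_others[of "S - {s1}" 3] s1 by auto
  obtain s3 where s3: "s3 \<in> S - {s1} - {s2}" "card (S - {s1} - {s2} - {s3}) = 2"
      "\<forall>y\<in>S - {s1} - {s2} - {s3}. s3 < y"
    using ex_less_all_others[of "S - {s1} - {s2}" 2] s2 by auto
  obtain s4 where s4: "s4 \<in> S - {s1} - {s2} - {s3}" "card (S - {s1} - {s2} - {s3} - {s4}) = 1"
      "\<forall>y\<in>S - {s1} - {s2} - {s3} - {s4}. s4 < y"
    using ex_less_all_others[of "S - {s1} - {s2} - {s3}" 1] s3 by auto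
  obtain s5 where s5: "s5 \<in> S - {s1} - {s2} - {s3} - {s4}"
    using s4(2) by (metis card.empty ex_in_conv zero_neq_one)
  have o: "s1 < s2" "s2 < s3" "s3 < s4" "s4 < s5" using s1 s2 s3 s4 s5 by blast+
  have pick: "\<exists>a b a' d. linked i i' (a, b) (a', d) \<and> s = ctime a b" if "s \<in> S" for s
    using that S(1) by force
  obtain a1 b1 a1' d1 where 1: "linked i i' (a1, b1) (a1', d1)" "s1 = ctime a1 b1" using pick s1 by blast
  obtain a2 b2 a2' d2 where 2: "linked i i' (a2, b2) (a2', d2)" "s2 = ctime a2 b2" using pick s2 by blast
  obtain a3 b3 a3' d3 where 3: "linked i i' (a3, b3) (a3', d3)" "s3 = ctime a3 b3" using pick s3 by blast
  obtain a4 b4 a4' d4 where 4: "linked i i' (a4, b4) (a4', d4)" "s4 = ctime a4 b4" using pick s4 by blast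
  obtain a5 b5 a5' d5 where 5: "linked i i' (a5, b5) (a5', d5)" "s5 = ctime a5 b5" using pick s5 by blast
  show False
    using no_five_linked[OF 1(1) 2(1) 3(1) 4(1) 5(1)] o 1(2) 2(2) 3(2) 4(2) 5(2) by simp
qed

end

section \<open>Repeated edges and the death count\<close>

context touching
begin

lemma finite_L: "finite L"
  using L_sub finite_F finite_subset by auto

text \<open>The inequality is strict, so a curve is not yet counted at its own death;
  \<open>deaths_less\<close> depends on this.\<close>

definition deaths :: "real \<Rightarrow> nat" where
  "deaths t = card {i \<in> L. r i < t}"

lemma deaths_mono: "s \<le> t \<Longrightarrow> deaths s \<le> deaths t"
  unfolding deaths_def by (rule card_mono) (use finite_L in auto)

lemma deaths_less: "i \<in> L \<Longrightarrow> r i < t \<Longrightarrow> deaths (r i) < deaths t"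
  unfolding deaths_def by (rule psubset_card_mono) (use finite_L in auto)

lemma deaths_le: "deaths t \<le> card L"
  unfolding deaths_def by (rule card_mono) (use finite_L in auto)

text \<open>Whichever curve touches \<open>a\<close> or \<open>b\<close> at a given time is then the
  upper one of \<open>i\<close> and \<open>i'\<close>. If \<open>i\<close> were still alive at
  \<open>tt i' b\<close>, the touches at \<open>tt i' a\<close>, \<open>tt i a\<close> and
  \<open>tt i' b\<close> would make the two swap twice.\<close>

lemma consec_shared:
  assumes "consec i a b" "consec i' a b" and less: "tt i' a < tt i a"
  shows "r i < tt i' b"
proof (rule ccontr)
  assume neg: "\<not> ?thesis"
  note A = consecD[OF assms(1)] and B = consecD[OF assms(2)]
    and C = consec_ctime[OF assms(1)] and D = consec_ctime[OF assms(2)]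
  note P = PF[OF A(1)] PF[OF A(2)] PF[OF B(1)] PF[OF B(2)]
  have ii': "i \<noteq> i'" using less by auto
  have o: "tt i a < tt i' b" using C D by simp
  have "f i' (tt i a) \<le> f i (tt i a)"
    using below[OF B(1), of "tt i a"] touch[OF A(1)] o P by auto
  moreover have "f i' (tt i a) \<noteq> f i (tt i a)"
    using no_triple[of i a i' "tt i a"] touch[OF A(1)] P ii' o by auto
  ultimately have "f i' (tt i a) < f i (tt i a)" by simp
  moreover have "f i (tt i' a) \<le> f i' (tt i' a)"
    using below[OF A(1), of "tt i' a"] touch[OF B(1)] less P by auto
  moreover have "f i (tt i' b) \<le> f i' (tt i' b)"
    using below[OF A(2), of "tt i' b"] touch[OF B(2)] neg P by auto
  ultimately show False
    using no_double_swap[of i i' "tt i' a" "tt i a" "tt i' b"] P less o neg by auto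
qed

text \<open>Division by \<open>k ^ l\<close> drops the last \<open>l\<close> digits in base
  \<open>k\<close>. The leading digits are constant between the two touches and, for
  \<open>l > 0\<close>, not yet those at the death of \<open>i\<close>.\<close>

definition good :: "nat \<Rightarrow> nat \<Rightarrow> 'a \<Rightarrow> 'a \<Rightarrow> 'a \<Rightarrow> bool" where
  "good k l i a b \<longleftrightarrow> consec i a b \<and> deaths (tt i a) div k ^ l = deaths (tt i b) div k ^ l \<and>
     (l = 0 \<or> deaths (tt i a) div k ^ l \<noteq> deaths (r i) div k ^ l)"

text \<open>If \<open>i'\<close> touches \<open>a\<close> first, then \<open>i\<close> dies before
  \<open>i'\<close> reaches \<open>b\<close>. The leading digits are constant between the touches of
  \<open>i'\<close>, so by monotonicity they agree at \<open>tt i a\<close> and \<open>r i\<close>,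
  which is excluded for \<open>l > 0\<close>. For \<open>l = 0\<close> the death of \<open>i\<close>
  itself changes the count.\<close>

lemma good_unique:
  assumes "good k l i a b" "good k l i' a b"
  shows "i = i'"
proof -
  have no: False if g: "good k l i a b" "good k l i' a b" and less: "tt i' a < tt i a" for i i'
  proof -
    have con: "consec i a b" "consec i' a b" using g by (auto simp: good_def)
    note A = consecD[OF con(1)] and B = consecD[OF con(2)]
    have d: "deaths (tt i' a) \<le> deaths (tt i a)" "deaths (tt i a) \<le> deaths (tt i b)"
      "deaths (tt i b) \<le> deaths (r i)"
      using deaths_mono less A PF[OF A(2)] by auto
    have e: "deaths (r i) < deaths (tt i' b)"
      using deaths_less consec_shared[OF con less] PF[OF A(1)] by auto
    show False
    proof (cases "l = 0")
      case True
      then show ?thesis using g d e by (auto simp: good_def)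
    next
      case False
      have "deaths (tt i' a) div k ^ l \<le> deaths (tt i a) div k ^ l"
        "deaths (tt i a) div k ^ l \<le> deaths (r i) div k ^ l"
        "deaths (r i) div k ^ l \<le> deaths (tt i' b) div k ^ l"
        using d e by (auto intro!: div_le_mono)
      then show ?thesis using g False by (auto simp: good_def)
    qed
  qed
  show ?thesis
  proof (rule ccontr)
    assume ne: "i \<noteq> i'"
    have con: "consec i a b" "consec i' a b" using assms by (auto simp: good_def)
    note A = consecD[OF con(1)] and B = consecD[OF con(2)]
    have "tt i a = tt i' a" using no[OF assms] no[OF assms(2,1)] by fastforce
    then show False
      using no_triple[of a i i' "tt i a"] touch[OF A(1)] touch[OF B(1)] PF[OF A(1)] PF[OF B(1)] ne by auto
  qed
qed

definition good_pairs :: "nat \<Rightarrow> nat \<Rightarrow> ('a \<times> 'a) set" where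
  "good_pairs k l = {(a, b). \<exists>i. good k l i a b}"

lemma good_pairs_J: "good_pairs k l \<subseteq> J \<times> J"
  using PF(3) by (auto simp: good_pairs_def good_def consec_def)

lemma good_pairs_cross: "(a, b) \<in> good_pairs k l \<Longrightarrow> \<exists>s. crosses a b s"
  using consec_ctime by (auto simp: good_pairs_def good_def)

lemma linked_J: "linked i i' e e' \<Longrightarrow> e \<in> J \<times> J \<and> e' \<in> J \<times> J"
  using PF(3) by (auto simp: linked_def consec_def mem_Times_iff)

lemma finite_linked: "finite {(e, e'). linked i i' e e'}"
proof (rule finite_subset)
  show "{(e, e'). linked i i' e e'} \<subseteq> (J \<times> J) \<times> (J \<times> J)"
    by (rule subrelI) (drule CollectD, drule case_prodD, drule linked_J, simp only: mem_Times_iff fst_conv snd_conv)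
qed (use finite_J in simp)

lemma card_diamonds_good: "card (diamonds (good_pairs k l)) \<le> card L * card L * 4"
proof -
  let ?S = "\<lambda>p. {(e, e'). linked (fst p) (snd p) e e'}"
  have "diamonds (good_pairs k l) \<subseteq> (\<Union>p\<in>L \<times> L. ?S p)"
  proof
    fix x assume x: "x \<in> diamonds (good_pairs k l)"
    obtain a b a' d where [simp]: "x = ((a, b), (a', d))" by (metis prod.collapse)
    have "(a, b) \<in> good_pairs k l" "(a', d) \<in> good_pairs k l"
      and dia: "diamond a b (ctime a b) a' d (ctime a' d)"
      using x by (auto simp: diamonds_def)
    then obtain i i' where i: "consec i a b" "consec i' a' d"
      by (auto simp: good_pairs_def good_def)
    then have "i \<in> L" "i' \<in> L" "a \<in> J" "b \<in> J" "a' \<in> J" "d \<in> J" using PF(3,4)[OF consecD(1)[OF i(1)]] PF(3)[OF consecD(2)[OF i(1)]]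
        PF(3,4)[OF consecD(1)[OF i(2)]] PF(3)[OF consecD(2)[OF i(2)]] by auto
    moreover have "linked i i' (a, b) (a', d)" using i dia by (simp add: linked_def)
    ultimately show "x \<in> (\<Union>p\<in>L \<times> L. ?S p)" by auto
  qed
  then have "card (diamonds (good_pairs k l)) \<le> card (\<Union>p\<in>L \<times> L. ?S p)"
    by (intro card_mono finite_UN_I finite_linked finite_SigmaI finite_L)
  also have "\<dots> \<le> (\<Sum>p\<in>L \<times> L. card (?S p))"
    by (rule card_UN_le) (use finite_L in auto)
  also have "\<dots> \<le> (\<Sum>p\<in>L \<times> L. 4)"
  proof (rule sum_mono)
    fix p assume "p \<in> L \<times> L"
    show "card (?S p) \<le> 4" by (rule card_linked)
  qed
  finally show ?thesis by (simp add: card_cartesian_product)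
qed

text \<open>Sampling with probability \<open>1 / k\<close> gives \<open>3 * N * k\<close> for the
  vertices. The at most \<open>4 * N ^ 2\<close> diamonds contribute
  \<open>4 * N ^ 2 / k ^ 2\<close>, at most \<open>4 * N * k\<close> because
  \<open>N \<le> k ^ 3\<close>.\<close>

lemma card_good_pairs:
  assumes k: "k \<ge> 1" "card L \<le> N" "card J \<le> N" "N \<le> k ^ 3"
  shows "card (good_pairs k l) \<le> 7 * N * k"
proof -
  have kpos: "real k > 0" using k by simp
  have "real (card (diamonds (good_pairs k l))) \<le> real (card L * card L * 4)"
    using card_diamonds_good of_nat_le_iff by blast
  also have "\<dots> \<le> real (N * N * 4)"
    using k by (intro of_nat_mono mult_mono) auto
  also have "\<dots> \<le> real (N * k ^ 3 * 4)"
    using k by (intro of_nat_mono mult_mono) auto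
  finally have "real (card (diamonds (good_pairs k l))) / real k ^ 2 \<le> real (N * k ^ 3 * 4) / real k ^ 2"
    by (rule divide_right_mono) simp
  also have "\<dots> = 4 * real N * real k"
    using kpos by (simp add: field_simps power2_eq_square power3_eq_cube)
  finally have 1: "real (card (diamonds (good_pairs k l))) / real k ^ 2 \<le> 4 * real N * real k" .
  have "real (card J) * real k \<le> real N * real k" using k by (intro mult_right_mono) auto
  moreover have "real (card (good_pairs k l)) \<le>
      3 * real (card J) * real k + real (card (diamonds (good_pairs k l))) / real k ^ 2"
    by (rule card_sampled[OF good_pairs_J good_pairs_cross k(1)])
  ultimately have "real (card (good_pairs k l)) \<le> 7 * real N * real k"
    using 1 by linarith
  then have "real (card (good_pairs k l)) \<le> real (7 * N * k)" by simp
  then show ?thesis using of_nat_le_iff by blast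
qed

lemma ex_consec:
  assumes "(i, a) \<in> P" "(i, b) \<in> P" "tt i a < tt i b"
  shows "\<exists>d. consec i a d"
proof -
  let ?S = "{d. (i, d) \<in> P \<and> tt i a < tt i d}"
  have "?S \<subseteq> J" using PF by auto
  then have "finite ?S" using finite_J finite_subset by blast
  then obtain d where "d \<in> ?S" "\<forall>y\<in>?S. tt i d \<le> tt i y"
    using ex_arg_min[of ?S "tt i"] assms by blast
  then show ?thesis using assms by (intro exI[of _ d]) (force simp: consec_def)
qed

text \<open>Each curve of \<open>L\<close> discards the consecutive pairs during which a digit of the base-\<open>k\<close>
  death count changes, a digit being watched only while the higher ones agree with those at the
  curve's own death; this costs \<open>3 k\<close> pairs. The remaining ones fall into three classes without
  shared pairs.\<close>

lemma card_cut:
  assumes k: "k \<ge> 1"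
  shows "card {(i, a). \<exists>b. consec i a b \<and> deaths (tt i a) div k ^ l \<noteq> deaths (tt i b) div k ^ l \<and>
      deaths (tt i a) div k ^ Suc l = deaths (r i) div k ^ Suc l} \<le> card L * k" (is "card ?B \<le> _")
proof -
  \<comment> \<open>Records the digit at position \<open>l\<close> at the first touch. Along the cut
    pairs of one \<open>i\<close> the truncated counts increase strictly while the digits above stay
    fixed, so the recorded digits differ.\<close>
  define g where "g p = (fst p, (deaths (tt (fst p) (snd p)) div k ^ l) mod k)" for p
  have no: False if p: "(i, a) \<in> ?B" "(i, a2) \<in> ?B" "g (i, a) = g (i, a2)" "tt i a < tt i a2" for i a a2
  proof -
    let ?x = "deaths (tt i a) div k ^ l" and ?y = "deaths (tt i a2) div k ^ l"
    obtain b where b: "consec i a b" "?x \<noteq> deaths (tt i b) div k ^ l" using p by auto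
    obtain b2 where b2: "consec i a2 b2" using p by auto
    have "tt i b \<le> tt i a2" using consecD(4)[OF b(1) consecD(1)[OF b2]] p(4) by auto
    then have "deaths (tt i b) div k ^ l \<le> ?y" by (intro div_le_mono deaths_mono)
    moreover have "?x \<le> deaths (tt i b) div k ^ l"
      using consecD(3)[OF b(1)] by (intro div_le_mono deaths_mono) auto
    ultimately have "?x < ?y" using b(2) by auto
    moreover have "?x div k = ?y div k"
      using p(1,2) by (auto simp: div_mult2_eq[symmetric] mult.commute)
    moreover have "?x mod k = ?y mod k" using p(3) by (simp add: g_def)
    ultimately show False by (metis div_mult_mod_eq less_irrefl)
  qed
  have "inj_on g ?B"
  proof (rule inj_onI)
    fix x y assume xy: "x \<in> ?B" "y \<in> ?B" "g x = g y"
    obtain i a i' a2 where [simp]: "x = (i, a)" "y = (i', a2)" by (metis prod.collapse)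
    have i: "i' = i" using xy(3) by (simp add: g_def)
    have "tt i a = tt i a2"
      using no[of i a a2] no[of i a2 a] xy i by fastforce
    moreover have "(i, a) \<in> P" "(i, a2) \<in> P" using xy i consecD(1) by auto
    ultimately show "x = y" using tt_inj i by auto
  qed
  moreover have "g ` ?B \<subseteq> L \<times> {..<k}"
    using k consecD(1) PF(4) by (fastforce simp: g_def)
  ultimately have "card ?B \<le> card (L \<times> {..<k})"
    using finite_L by (intro card_inj_on_le[of g]) auto
  then show ?thesis by (simp add: card_cartesian_product)
qed

lemma card_good:
  "card {(i, a). \<exists>b. good k l i a b} \<le> card (good_pairs k l)"
proof (rule card_inj_on_le)
  let ?g = "\<lambda>p. (snd p, SOME b. good k l (fst p) (snd p) b)"
  have g: "good k l i a (snd (?g (i, a)))" if "\<exists>b. good k l i a b" for i a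
    using someI_ex[OF that] by simp
  show "inj_on ?g {(i, a). \<exists>b. good k l i a b}"
  proof (rule inj_onI)
    fix x y assume xy: "x \<in> {(i, a). \<exists>b. good k l i a b}" "y \<in> {(i, a). \<exists>b. good k l i a b}" "?g x = ?g y"
    obtain i a i' a2 where [simp]: "x = (i, a)" "y = (i', a2)" by (metis prod.collapse)
    have "a = a2" using xy(3) by simp
    moreover have "good k l i a (snd (?g (i, a)))" "good k l i' a2 (snd (?g (i', a2)))" using xy g by auto
    ultimately have "i = i'" using good_unique xy(3) by auto
    then show "x = y" using \<open>a = a2\<close> by simp
  qed
  show "?g ` {(i, a). \<exists>b. good k l i a b} \<subseteq> good_pairs k l"
  proof
    fix x assume "x \<in> ?g ` {(i, a). \<exists>b. good k l i a b}"
    then obtain p where p: "x = ?g p" "p \<in> {(i, a). \<exists>b. good k l i a b}" by (rule imageE)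
    have "\<exists>b. good k l (fst p) (snd p) b" using p(2) by (simp add: case_prod_beta)
    from someI_ex[OF this] have "good k l (fst p) (snd p) (snd (?g p))" by simp
    then show "x \<in> good_pairs k l" using p(1) by (auto simp: good_pairs_def)
  qed
  show "finite (good_pairs k l)"
    using good_pairs_J finite_J finite_subset by blast
qed

text \<open>The constant is \<open>1 + 3 * 7 + 3\<close>: the last touches, three good classes and
  three cut classes, with \<open>N \<le> N * k\<close>.\<close>

lemma card_touching:
  assumes k: "k \<ge> 1" "card L \<le> N" "card J \<le> N" "N < k ^ 3"
  shows "card P \<le> 25 * N * k"
proof -
  define A where "A l = {(i, a). \<exists>b. good k l i a b}" for l
  define B where "B l = {(i, a). \<exists>b. consec i a b \<and> deaths (tt i a) div k ^ l \<noteq> deaths (tt i b) div k ^ l \<and>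
      deaths (tt i a) div k ^ Suc l = deaths (r i) div k ^ Suc l}" for l
  \<comment> \<open>Last touches start no consecutive pair; there is at most one for each curve of
    \<open>L\<close>.\<close>
  define C where "C = {(i, a) \<in> P. \<forall>b. (i, b) \<in> P \<longrightarrow> tt i b \<le> tt i a}"
  have small: "deaths t div k ^ 3 = 0" for t
    using deaths_le[of t] k by (intro div_less) linarith
  have cover: "(i, a) \<in> (\<Union>l\<in>{0,1,2}. A l) \<union> (\<Union>l\<in>{0,1,2}. B l)" if "consec i a b" for i a b
  proof -
    \<comment> \<open>Agreement of the leading digits at both touches and at the death of
      \<open>i\<close>. It holds at level 3, where nothing is left of the counts. Going down to the
      first level where it fails, or to level 0, the pair is cut there if the two touches disagree,
      and good otherwise.\<close>
    define Q where "Q m \<longleftrightarrow> deaths (tt i a) div k ^ m = deaths (tt i b) div k ^ m \<and>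
      deaths (tt i a) div k ^ m = deaths (r i) div k ^ m" for m
    have step: "(i, a) \<in> A l \<union> B l" if "Q (Suc l)" "\<not> Q l \<or> l = 0" for l
      using that \<open>consec i a b\<close> unfolding Q_def good_def A_def B_def by auto
    have "Q 3" using small by (simp add: Q_def)
    then have "Q (Suc 2)" by (simp add: numeral_3_eq_3 numeral_2_eq_2)
    have "\<exists>l\<in>{0,1,2}. Q (Suc l) \<and> (\<not> Q l \<or> l = 0)"
    proof (cases "Q 2")
      case True
      then have "Q (Suc 1)" by (simp add: numeral_2_eq_2)
      then show ?thesis by (cases "Q 1") auto
    qed (use \<open>Q (Suc 2)\<close> in blast)
    then obtain l where l: "l \<in> {0,1,2}" "Q (Suc l)" "\<not> Q l \<or> l = 0" by blast
    from step[OF l(2,3)] l(1) show ?thesis by blast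
  qed
  have "P \<subseteq> C \<union> ((\<Union>l\<in>{0,1,2}. A l) \<union> (\<Union>l\<in>{0,1,2}. B l))"
  proof
    fix p assume p: "p \<in> P"
    obtain i a where [simp]: "p = (i, a)" by fastforce
    show "p \<in> C \<union> ((\<Union>l\<in>{0,1,2}. A l) \<union> (\<Union>l\<in>{0,1,2}. B l))"
    proof (cases "p \<in> C")
      case False
      then obtain b where "(i, b) \<in> P" "tt i a < tt i b" using p by (auto simp: C_def not_le)
      then obtain d where "consec i a d" using ex_consec p by force
      then show ?thesis using cover[of i a d] by simp
    qed auto
  qed
  moreover have AP: "A l \<subseteq> P" "B l \<subseteq> P" for l using consecD(1) by (auto simp: A_def B_def good_def)
  moreover have "C \<subseteq> P" by (auto simp: C_def)
  ultimately have "card P \<le> card (C \<union> ((\<Union>l\<in>{0,1,2}. A l) \<union> (\<Union>l\<in>{0,1,2}. B l)))"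
    by (intro card_mono finite_subset[OF _ finite_P] Un_least UN_least)
  also have "\<dots> \<le> card C + (card (\<Union>l\<in>{0,1,2}. A l) + card (\<Union>l\<in>{0,1,2}. B l))"
    by (meson card_Un_le add_left_mono order_trans)
  also have "\<dots> \<le> N + ((\<Sum>l\<in>{0,1,2}. card (A l)) + (\<Sum>l\<in>{0,1,2}. card (B l)))"
  proof (intro add_mono card_UN_le)
    have "inj_on fst C"
    proof (rule inj_onI)
      fix x y assume xy: "x \<in> C" "y \<in> C" "fst x = fst y"
      obtain i a i' a2 where [simp]: "x = (i, a)" "y = (i', a2)" by (metis prod.collapse)
      have "tt i a = tt i a2" using xy by (auto simp: C_def intro: order.antisym)
      then show "x = y" using tt_inj xy by (auto simp: C_def)
    qed
    then have "card C \<le> card L"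
      using finite_L P_sub by (intro card_inj_on_le[of fst]) (auto simp: C_def)
    then show "card C \<le> N" using k by simp
  qed auto
  also have "\<dots> \<le> N + ((\<Sum>l\<in>{0,1,2::nat}. 7 * N * k) + (\<Sum>l\<in>{0,1,2::nat}. N * k))"
  proof (intro add_mono order_refl sum_mono)
    fix l :: nat
    show "card (A l) \<le> 7 * N * k"
      using card_good[of k l] card_good_pairs[of k N l] k by (simp add: A_def)
    show "card (B l) \<le> N * k"
      using card_cut[OF k(1), of l] mult_right_mono[OF k(2), of k] unfolding B_def by linarith
  qed
  also have "\<dots> = N + 24 * N * k" by simp
  also have "\<dots> \<le> 25 * N * k"
  proof -
    have "N \<le> N * k" using k by simp
    then show ?thesis by simp
  qed
  finally show ?thesis .
qed

end

section \<open>The upper bound\<close>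

lemma (in curve_system) curve_system_mono:
  assumes "F' \<subseteq> F" "\<And>i. i \<in> F' \<Longrightarrow> r' i \<le> r i"
  shows "curve_system F' f c r'"
proof
  show "finite F'" by (rule finite_subset[OF assms(1) finite_F])
  show "continuous_on {c..r' i} (f i)" if "i \<in> F'" for i
    by (rule continuous_on_subset[OF cont[of i]]) (use assms(1) assms(2)[OF that] that in auto)
  show "s = t" if "i \<in> F'" "j \<in> F'" "i \<noteq> j" "c \<le> s" "s \<le> r' i" "s \<le> r' j" "c \<le> t" "t \<le> r' i" "t \<le> r' j"
    "f i s = f j s" "f i t = f j t" for i j s t
    by (rule meet_once[of i j]) (use that assms order_trans in blast)+
  show False if "i \<in> F'" "j \<in> F'" "k \<in> F'" "i \<noteq> j" "i \<noteq> k" "j \<noteq> k" "c \<le> t" "t \<le> r' i" "t \<le> r' j"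
    "t \<le> r' k" "f i t = f j t" "f i t = f k t" for i j k t
    by (rule no_triple[of i j k t]) (use that assms order_trans in blast)+
qed

lemma (in curve_system) curve_system_reflect: "curve_system F (\<lambda>i t. - f i t) c r"
proof
  show "finite F" by (rule finite_F)
  show "continuous_on {c..r i} (\<lambda>t. - f i t)" if "i \<in> F" for i
    by (intro continuous_intros cont that)
  show "s = t" if "i \<in> F" "j \<in> F" "i \<noteq> j" "c \<le> s" "s \<le> r i" "s \<le> r j" "c \<le> t" "t \<le> r i" "t \<le> r j"
    "- f i s = - f j s" "- f i t = - f j t" for i j s t
    by (rule meet_once[of i j]) (use that in auto)
  show False if "i \<in> F" "j \<in> F" "k \<in> F" "i \<noteq> j" "i \<noteq> k" "j \<noteq> k" "c \<le> t" "t \<le> r i" "t \<le> r j"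
    "t \<le> r k" "- f i t = - f j t" "- f i t = - f k t" for i j k t
    by (rule no_triple[of i j k t]) (use that in auto)
qed

text \<open>Cutting the curves of \<open>B\<close> at the last death in \<open>A\<close> keeps all
  their contacts with \<open>A\<close> and makes \<open>B\<close> a pencil.\<close>

lemma (in curve_system) card_touching_layers:
  assumes AB: "A \<subseteq> F" "B \<subseteq> F" "A \<inter> B = {}" and r: "\<And>i j. i \<in> A \<Longrightarrow> j \<in> B \<Longrightarrow> r i \<le> r j"
    and N: "card A \<le> N" "card B \<le> N" "N < k ^ 3"
  shows "card {(i, j) \<in> A \<times> B. (\<exists>x. c \<le> x \<and> x \<le> r i \<and> f i x = f j x) \<and>
      (\<forall>t. c \<le> t \<and> t \<le> r i \<longrightarrow> f i t \<le> f j t)} \<le> 25 * N * k" (is "card ?P \<le> _")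
proof (cases "A = {}")
  case False
  have finA: "finite A" by (rule finite_subset[OF AB(1) finite_F])
  define \<mu> where "\<mu> = Max (r ` A)"
  have \<mu>: "\<And>i. i \<in> A \<Longrightarrow> r i \<le> \<mu>" "\<And>j. j \<in> B \<Longrightarrow> \<mu> \<le> r j"
    using finA False r by (auto simp: \<mu>_def)
  define r' where "r' i = (if i \<in> B then \<mu> else r i)" for i
  have rA: "\<And>i. i \<in> A \<Longrightarrow> r' i = r i" using AB by (auto simp: r'_def)
  interpret S: curve_system "A \<union> B" f c r'
    by (rule curve_system_mono) (use AB \<mu> in \<open>auto simp: r'_def\<close>)
  define tt where "tt i j = (SOME x. c \<le> x \<and> x \<le> r i \<and> f i x = f j x)" for i j
  interpret S: touching "A \<union> B" f c r' B \<mu> A ?P tt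
  proof
    show "c \<le> tt i a \<and> tt i a \<le> r' i \<and> f i (tt i a) = f a (tt i a)" if "(i, a) \<in> ?P" for i a
    proof -
      have "\<exists>x. c \<le> x \<and> x \<le> r i \<and> f i x = f a x" using that by auto
      from someI_ex[OF this] show ?thesis using that rA by (auto simp: tt_def)
    qed
  qed (use AB \<mu> rA in \<open>auto simp: r'_def\<close>)
  have "k \<ge> 1" using N by (cases "k = 0") auto
  then show ?thesis using S.card_touching[of k N] N by simp
qed auto

section \<open>Divide and conquer by right endpoint\<close>

context curve_system
begin

definition below_touching :: "'a \<Rightarrow> 'a \<Rightarrow> bool" where
  "below_touching i j \<longleftrightarrow> i \<noteq> j \<and> (\<exists>x. c \<le> x \<and> x \<le> r i \<and> x \<le> r j \<and> f i x = f j x) \<and>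
     (\<forall>t. c \<le> t \<and> t \<le> r i \<and> t \<le> r j \<longrightarrow> f i t \<le> f j t)"

definition touching_pairs :: "'a set \<Rightarrow> 'a set set" where
  "touching_pairs S = {{i, j} | i j. i \<in> S \<and> j \<in> S \<and> below_touching i j}"

lemma finite_touching_pairs: "finite S \<Longrightarrow> finite (touching_pairs S)"
  by (rule finite_subset[of _ "Pow S"]) (auto simp: touching_pairs_def)

text \<open>A mixed pair whose longer-lived curve is the lower one becomes a touch from below after
  reflection in the \<open>x\<close>-axis; each of the two kinds costs
  \<open>25 * N * k\<close>.\<close>

lemma touching_pairs_split:
  assumes AB: "A \<subseteq> F" "B \<subseteq> F" "A \<inter> B = {}" and r: "\<And>i j. i \<in> A \<Longrightarrow> j \<in> B \<Longrightarrow> r i \<le> r j"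
    and N: "card A \<le> N" "card B \<le> N" "N < k ^ 3"
  shows "card (touching_pairs (A \<union> B)) \<le> card (touching_pairs A) + card (touching_pairs B) + 50 * N * k"
proof -
  interpret neg: curve_system F "\<lambda>i t. - f i t" c r by (rule curve_system_reflect)
  let ?P = "{(i, j) \<in> A \<times> B. (\<exists>x. c \<le> x \<and> x \<le> r i \<and> f i x = f j x) \<and>
      (\<forall>t. c \<le> t \<and> t \<le> r i \<longrightarrow> f i t \<le> f j t)}"
  let ?Q = "{(i, j) \<in> A \<times> B. (\<exists>x. c \<le> x \<and> x \<le> r i \<and> - f i x = - f j x) \<and>
      (\<forall>t. c \<le> t \<and> t \<le> r i \<longrightarrow> - f i t \<le> - f j t)}"
  let ?g = "\<lambda>p. {fst p, snd p}"
  have fin: "finite A" "finite B" using finite_subset[OF _ finite_F] AB by auto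
  have sub: "touching_pairs (A \<union> B) \<subseteq> touching_pairs A \<union> touching_pairs B \<union> ?g ` ?P \<union> ?g ` ?Q"
  proof
    fix e assume "e \<in> touching_pairs (A \<union> B)"
    then obtain i j where e: "e = {i, j}" "i \<in> A \<union> B" "j \<in> A \<union> B" and t: "below_touching i j"
      by (auto simp: touching_pairs_def)
    consider "i \<in> A \<and> j \<in> A" | "i \<in> B \<and> j \<in> B" | "i \<in> A" "j \<in> B" | "i \<in> B" "j \<in> A" using e by auto
    then show "e \<in> touching_pairs A \<union> touching_pairs B \<union> ?g ` ?P \<union> ?g ` ?Q"
    proof cases
      case 1
      then show ?thesis using e t by (auto simp: touching_pairs_def)
    next
      case 2
      then show ?thesis using e t by (auto simp: touching_pairs_def)
    next
      case 3
      have rr: "r i \<le> r j" using r 3 by auto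
      have "(i, j) \<in> ?P" using 3 t order_trans[OF _ rr] unfolding below_touching_def by blast
      then have "?g (i, j) \<in> ?g ` ?P" by (rule imageI)
      then show ?thesis using e by simp
    next
      case 4
      have rr: "r j \<le> r i" using r 4 by auto
      have "(j, i) \<in> ?Q" using 4 t order_trans[OF _ rr] unfolding below_touching_def neg_equal_iff_equal neg_le_iff_le
        by (auto intro: exI[of _ "_ :: real"]; metis)
      then have "?g (j, i) \<in> ?g ` ?Q" by (rule imageI)
      then show ?thesis using e by (simp add: insert_commute)
    qed
  qed
  have finPQ: "finite ?P" "finite ?Q" using fin by (auto intro: finite_subset[of _ "A \<times> B"])
  have "card (touching_pairs (A \<union> B)) \<le> card (touching_pairs A \<union> touching_pairs B \<union> ?g ` ?P \<union> ?g ` ?Q)"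
    by (rule card_mono[OF _ sub]) (use fin finPQ finite_touching_pairs in blast)
  also have "\<dots> \<le> card (touching_pairs A) + card (touching_pairs B) + card (?g ` ?P) + card (?g ` ?Q)"
    by (meson card_Un_le add_right_mono order_trans)
  also have "card (?g ` ?P) \<le> 25 * N * k"
    by (rule order_trans[OF card_image_le[OF finPQ(1)] card_touching_layers[OF AB r N]])
  also have "card (?g ` ?Q) \<le> 25 * N * k"
    by (rule order_trans[OF card_image_le[OF finPQ(2)] neg.card_touching_layers[OF AB r N]])
  finally show ?thesis by simp
qed

lemma ex_earliest_deaths:
  assumes "finite S" "n \<le> card S"
  shows "\<exists>A\<subseteq>S. card A = n \<and> (\<forall>x\<in>A. \<forall>y\<in>S - A. r x \<le> r y)"
  using assms(2)
proof (induction n)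
  case 0
  then show ?case by (intro exI[of _ "{}"]) auto
next
  case (Suc n)
  then obtain A where A: "A \<subseteq> S" "card A = n" "\<forall>x\<in>A. \<forall>y\<in>S - A. r x \<le> r y" by auto
  have finA: "finite A" using finite_subset[OF A(1) assms(1)] .
  have "S - A \<noteq> {}" using A Suc.prems by (metis Diff_eq_empty_iff Suc_n_not_le_n subset_antisym)
  then obtain z where z: "z \<in> S - A" "\<forall>y\<in>S - A. r z \<le> r y"
    using ex_arg_min[of "S - A" r] assms by auto
  show ?case
    by (rule exI[of _ "insert z A"]) (use A z finA in auto)
qed

text \<open>Writing \<open>x\<close> for \<open>(2 ^ m) powr (4 / 3)\<close>, two halves and the
  mixed pairs cost at most \<open>2 * 200 * x + 100 * x\<close>. The constant 200 is chosen so that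
  this is \<open>200 * (5 / 2) * x\<close>, with \<open>5 / 2 \<le> 2 powr (4 / 3)\<close>.\<close>

lemma card_touching_pairs_pow2:
  assumes "S \<subseteq> F" "card S \<le> 2 ^ m"
  shows "real (card (touching_pairs S)) \<le> 200 * (2 ^ m) powr (4 / 3)"
  using assms
proof (induction m arbitrary: S)
  case 0
  have finS: "finite S" using finite_subset[OF _ finite_F] 0 by simp
  have "touching_pairs S = {}"
  proof -
    have "i = j" if "i \<in> S" "j \<in> S" for i j
      using card_le_Suc0_iff_eq[OF finS] 0 that by simp
    then show ?thesis by (fastforce simp: touching_pairs_def below_touching_def)
  qed
  then show ?case by simp
next
  case (Suc m)
  have finS: "finite S" using finite_subset[OF _ finite_F] Suc.prems by simp
  define n where "n = min (card S) (2 ^ m)"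
  obtain A where A: "A \<subseteq> S" "card A = n" "\<forall>x\<in>A. \<forall>y\<in>S - A. r x \<le> r y"
    using ex_earliest_deaths[OF finS, of n] by (auto simp: n_def)
  have cA: "card A \<le> 2 ^ m" using A by (simp add: n_def)
  have "card (S - A) = card S - n" using A finS by (simp add: card_Diff_subset finite_subset)
  then have cB: "card (S - A) \<le> 2 ^ m" using Suc.prems by (auto simp: n_def min_def)
  \<comment> \<open>A power of two whose cube exceeds \<open>2 ^ m\<close>, yet at most twice the
    cube root of \<open>2 ^ m\<close>.\<close>
  define k :: nat where "k = 2 ^ Suc (m div 3)"
  have "(2::nat) ^ m < 2 ^ (Suc (m div 3) * 3)"
    by (rule power_strict_increasing) auto
  then have k: "2 ^ m < k ^ 3" by (simp only: k_def power_mult)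
  have S: "A \<union> (S - A) = S" using A by auto
  have "card (touching_pairs (A \<union> (S - A))) \<le>
      card (touching_pairs A) + card (touching_pairs (S - A)) + 50 * 2 ^ m * k"
    by (rule touching_pairs_split) (use A Suc.prems cA cB k in auto)
  from this[unfolded S] have "real (card (touching_pairs S)) \<le>
      real (card (touching_pairs A) + card (touching_pairs (S - A)) + 50 * 2 ^ m * k)"
    by (rule of_nat_mono)
  then have 1: "real (card (touching_pairs S)) \<le>
      real (card (touching_pairs A)) + real (card (touching_pairs (S - A))) + 50 * 2 ^ m * real k"
    by simp
  have "real k = 2 * 2 powr real (m div 3)" by (simp add: k_def powr_realpow)
  also have "\<dots> \<le> 2 * 2 powr (real m / 3)"
    by (intro mult_left_mono powr_mono) linarith+
  finally have k2: "real k \<le> 2 * 2 powr (real m / 3)" .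
  let ?x = "(2 ^ m :: real) powr (4 / 3)"
  have "?x = 2 powr (real m * (4 / 3))" by (simp flip: powr_realpow add: powr_powr)
  also have "\<dots> = 2 powr (real m + real m / 3)" by (rule arg_cong[where f = "\<lambda>x. 2 powr x"]) simp
  also have "\<dots> = 2 ^ m * 2 powr (real m / 3)" by (subst powr_add) (simp add: powr_realpow)
  finally have x: "?x = 2 ^ m * 2 powr (real m / 3)" .
  have "50 * 2 ^ m * real k \<le> 50 * 2 ^ m * (2 * 2 powr (real m / 3))"
    by (intro mult_left_mono k2) auto
  then have 2: "50 * 2 ^ m * real k \<le> 100 * ?x" unfolding x by simp
  have "real (card (touching_pairs A)) \<le> 200 * ?x" "real (card (touching_pairs (S - A))) \<le> 200 * ?x"
    using Suc.IH[of A] Suc.IH[of "S - A"] A Suc.prems cA cB by auto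
  then have 3: "real (card (touching_pairs S)) \<le> 500 * ?x" using 1 2 by linarith
  \<comment> \<open>After cubing, this reads \<open>125 / 8 \<le> 16\<close>.\<close>
  have "(5 / 2 :: real) \<le> 2 powr (4 / 3)"
  proof (rule power_le_imp_le_base[where n = 2])
    have "(2 powr (4 / 3)) ^ Suc 2 = (2::real) powr 4"
      by (subst powr_power) auto
    then show "(5 / 2 :: real) ^ Suc 2 \<le> (2 powr (4 / 3)) ^ Suc 2"
      by (simp add: power_numeral_reduce)
  qed simp
  then have "200 * (5 / 2) * ?x \<le> 200 * 2 powr (4 / 3) * ?x"
    by (intro mult_right_mono mult_left_mono) auto
  also have "\<dots> = 200 * (2 ^ Suc m) powr (4 / 3)" by (simp add: powr_mult)
  finally show ?case using 3 by simp
qed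

text \<open>Rounding the size up to a power of two less than twice as large costs a factor
  \<open>2 powr (4 / 3)\<close>, at most 3.\<close>

lemma card_touching_pairs:
  assumes "S \<subseteq> F"
  shows "real (card (touching_pairs S)) \<le> 600 * real (card S) powr (4 / 3)"
proof (cases "card S = 0")
  case True
  then have "S = {}" using finite_subset[OF assms finite_F] by simp
  then show ?thesis by (simp add: touching_pairs_def)
next
  case False
  let ?n = "card S"
  obtain m where m: "?n \<le> 2 ^ m" "2 ^ m < 2 * ?n"
  proof -
    obtain k where k: "2 ^ k \<le> ?n" "?n < 2 ^ Suc k"
      using ex_power_ivl1[of 2 ?n] False by auto
    show ?thesis
    proof (cases "2 ^ k = ?n")
      case True
      then show ?thesis using that[of k] k False by simp
    next
      case False
      then show ?thesis using that[of "Suc k"] k by simp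
    qed
  qed
  have "real (card (touching_pairs S)) \<le> 200 * (2 ^ m) powr (4 / 3)"
    by (rule card_touching_pairs_pow2[OF assms m(1)])
  also have "\<dots> \<le> 200 * (2 * real ?n) powr (4 / 3)"
  proof -
    have "real (2 ^ m) \<le> real (2 * ?n)" using m(2) by (intro of_nat_mono) simp
    then show ?thesis by (intro mult_left_mono powr_mono2) auto
  qed
  also have "\<dots> = 200 * 2 powr (4 / 3) * real ?n powr (4 / 3)" by (simp add: powr_mult)
  also have "\<dots> \<le> 600 * real ?n powr (4 / 3)"
  proof -
    have "(2::real) powr (4 / 3) \<le> 3"
    proof (rule power_le_imp_le_base[where n = 2])
      have "(2 powr (4 / 3)) ^ Suc 2 = (2::real) powr 4"
        by (subst powr_power) auto
      then show "(2 powr (4 / 3)) ^ Suc 2 \<le> (3::real) ^ Suc 2"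
        by (simp add: power_numeral_reduce)
    qed simp
    then show ?thesis by (intro mult_right_mono) auto
  qed
  finally show ?thesis .
qed

end

section \<open>From point sets to curve systems\<close>

lemma admissible_graphs:
  assumes "admissible_family n F"
  shows "\<exists>f c r. curve_system F f c r \<and>
    (\<forall>C\<in>F. \<forall>x y. (x, y) \<in> C \<longleftrightarrow> c \<le> x \<and> x \<le> r C \<and> y = f C x)"
proof -
  obtain c where c: "\<And>C. C \<in> F \<Longrightarrow> fst (left_endpoint C) = c"
    using assms by (auto simp: admissible_family_def)
  have "\<forall>C\<in>F. \<exists>p. continuous_on {c..snd p} (fst p) \<and> C = (\<lambda>x. (x, fst p x)) ` {c..snd p}"
  proof
    fix C assume C: "C \<in> F"
    then have "x_monotone C" using assms by (simp add: admissible_family_def)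
    then obtain g a b where g: "a < b" "continuous_on {a..b} g" "C = (\<lambda>x. (x, g x)) ` {a..b}"
      unfolding x_monotone_def by (elim exE conjE)
    have "a = c" using c[OF C] left_endpoint_graph[of a b g] g by simp
    then show "\<exists>p. continuous_on {c..snd p} (fst p) \<and> C = (\<lambda>x. (x, fst p x)) ` {c..snd p}"
      using g by (intro exI[of _ "(g, b)"]) simp
  qed
  from bchoice[OF this] obtain p where
    p: "\<forall>C\<in>F. continuous_on {c..snd (p C)} (fst (p C)) \<and> C = (\<lambda>x. (x, fst (p C) x)) ` {c..snd (p C)}"
    by (elim exE)
  define f r where "f C = fst (p C)" and "r C = snd (p C)" for C
  note p' = p[folded f_def r_def, rule_format]
  have mem: "(x, y) \<in> C \<longleftrightarrow> c \<le> x \<and> x \<le> r C \<and> y = f C x" if "C \<in> F" for C x y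
  proof -
    have "(x, y) \<in> C \<longleftrightarrow> (x, y) \<in> (\<lambda>x. (x, f C x)) ` {c..r C}"
      by (rule arg_cong[OF conjunct2[OF p'[OF that]]])
    also have "\<dots> \<longleftrightarrow> c \<le> x \<and> x \<le> r C \<and> y = f C x" by auto
    finally show ?thesis .
  qed
  have meet: "card (A \<inter> B) \<le> 1 \<and> finite (A \<inter> B)" if "A \<in> F" "B \<in> F" "A \<noteq> B" for A B
    using assms that by (auto simp: admissible_family_def)
  have trip: "A \<inter> B \<inter> C = {}" if "A \<in> F" "B \<in> F" "C \<in> F" "A \<noteq> B" "A \<noteq> C" "B \<noteq> C" for A B C
    using assms[unfolded admissible_family_def] that by (elim conjE) simp
  have "curve_system F f c r"
  proof
    show "finite F" using assms by (simp add: admissible_family_def)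
    show "continuous_on {c..r C} (f C)" if "C \<in> F" for C
      by (rule conjunct1[OF p'[OF that]])
    show "s = t" if "A \<in> F" "B \<in> F" "A \<noteq> B" "c \<le> s" "s \<le> r A" "s \<le> r B" "c \<le> t" "t \<le> r A" "t \<le> r B"
      "f A s = f B s" "f A t = f B t" for A B s t
    proof -
      have "(s, f A s) \<in> A \<inter> B" "(t, f A t) \<in> A \<inter> B" using that mem by auto
      moreover have "\<forall>p\<in>A \<inter> B. \<forall>q\<in>A \<inter> B. p = q"
        using meet[OF that(1-3)] card_le_Suc0_iff_eq[of "A \<inter> B"] by simp
      ultimately have "(s, f A s) = (t, f A t)" by blast
      then show ?thesis by simp
    qed
    show False if "A \<in> F" "B \<in> F" "C \<in> F" "A \<noteq> B" "A \<noteq> C" "B \<noteq> C" "c \<le> t" "t \<le> r A" "t \<le> r B"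
      "t \<le> r C" "f A t = f B t" "f A t = f C t" for A B C t
    proof -
      have "(t, f A t) \<in> A \<inter> B \<inter> C" using that mem by simp
      then show False using trip[OF that(1-6)] by blast
    qed
  qed
  then show ?thesis by (intro exI[of _ f] exI[of _ c] exI[of _ r] conjI ballI allI mem)
qed

text \<open>If neither curve stays weakly below the other, the order is strict in opposite
  directions at two times. \<open>crossesI\<close> yields an exchange of sides strictly between
  them, and it takes place at the only common point.\<close>

lemma (in curve_system) tangent_below_touching:
  fixes h :: "'a \<Rightarrow> point set"
  assumes mem: "\<And>C x y. C \<in> F \<Longrightarrow> (x, y) \<in> h C \<longleftrightarrow> c \<le> x \<and> x \<le> r C \<and> y = f C x"
    and A: "A \<in> F" and B: "B \<in> F" and "A \<noteq> B" and tan: "tangent (h A) (h B)"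
  shows "below_touching A B \<or> below_touching B A"
proof (rule ccontr)
  assume neg: "\<not> ?thesis"
  obtain p where p: "h A \<inter> h B = {p}" "\<not> crossing_point (h A) (h B) p"
    using tan by (auto simp: tangent_def)
  obtain x y where xy: "p = (x, y)" by fastforce
  have "(x, y) \<in> h A" "(x, y) \<in> h B" using p xy by auto
  then have x: "c \<le> x" "x \<le> r A" "x \<le> r B" "y = f A x" "y = f B x" using mem A B by auto
  then have "\<not> (\<forall>t. c \<le> t \<and> t \<le> r A \<and> t \<le> r B \<longrightarrow> f A t \<le> f B t)"
    "\<not> (\<forall>t. c \<le> t \<and> t \<le> r A \<and> t \<le> r B \<longrightarrow> f B t \<le> f A t)"
    using neg \<open>A \<noteq> B\<close> unfolding below_touching_def by auto
  then obtain s t where s: "c \<le> s" "s \<le> r A" "s \<le> r B" "f B s < f A s"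
    and t: "c \<le> t" "t \<le> r A" "t \<le> r B" "f A t < f B t" by (auto simp: not_le)
  have crossing: "strictly_below_on {x - (x - s)<..<x} (h X) (h Y) \<and> strictly_below_on {x<..<x + (t - x)} (h Y) (h X) \<and> s < x \<and> x < t"
    if XY: "X \<in> F" "Y \<in> F" "X \<noteq> Y" and s: "c \<le> s" "s \<le> r X" "s \<le> r Y" "f X s < f Y s"
      and t: "c \<le> t" "t \<le> r X" "t \<le> r Y" "f Y t < f X t" and st: "s < t"
      and x: "c \<le> x" "x \<le> r X" "x \<le> r Y" "f X x = f Y x" for X Y s t
  proof -
    obtain u where u: "s < u" "u < t" "crosses X Y u" using crossesI[OF XY(1,2) s(1) st t(2,3) s(4) t(4)] by blast
    have "u = x" using meet_once[of X Y u x] that u by (auto simp: crosses_def)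
    then show ?thesis
      using u s t XY by (auto simp: strictly_below_on_def crosses_def mem)
  qed
  \<comment> \<open>\<open>crossing_point\<close> asks for one radius on both sides, so the two
    neighbourhoods are shrunk to the smaller one.\<close>
  have e: "strictly_below_on {x - e<..<x} X Y" if "strictly_below_on {x - e'<..<x} X Y" "e \<le> e'" for X Y e e'
    using that by (force simp: strictly_below_on_def)
  have e2: "strictly_below_on {x<..<x + e} X Y" if "strictly_below_on {x<..<x + e'} X Y" "e \<le> e'" for X Y e e'
    using that by (force simp: strictly_below_on_def)
  have pAB: "p \<in> h A \<inter> h B" using p by auto
  have "s \<noteq> t" using s t by auto
  then consider "s < t" | "t < s" by linarith
  then have "crossing_point (h A) (h B) p"
  proof cases
    case 1
    have "strictly_below_on {x - (x - s)<..<x} (h B) (h A) \<and> strictly_below_on {x<..<x + (t - x)} (h A) (h B) \<and> s < x \<and> x < t"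
      by (rule crossing) (use 1 s t x A B \<open>A \<noteq> B\<close> in auto)
    then show ?thesis unfolding crossing_point_def using pAB xy e[of "x - s" _ _ "min (x - s) (t - x)"]
        e2[of "t - x" _ _ "min (x - s) (t - x)"]
      by (intro conjI exI[of _ "min (x - s) (t - x)"]) auto
  next
    case 2
    have "strictly_below_on {x - (x - t)<..<x} (h A) (h B) \<and> strictly_below_on {x<..<x + (s - x)} (h B) (h A) \<and> t < x \<and> x < s"
      by (rule crossing) (use 2 s t x A B \<open>A \<noteq> B\<close> in auto)
    then show ?thesis unfolding crossing_point_def using pAB xy e[of "x - t" _ _ "min (x - t) (s - x)"]
        e2[of "s - x" _ _ "min (x - t) (s - x)"]
      by (intro conjI exI[of _ "min (x - t) (s - x)"]) auto
  qed
  then show False using p by simp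
qed

lemma card_tangent_pairs_le:
  assumes "admissible_family n F"
  shows "real (card (tangent_pairs F)) \<le> 600 * real n powr (4 / 3)"
proof -
  obtain f c r where fcr: "curve_system F f c r"
    and mem: "\<forall>C\<in>F. \<forall>x y. (x, y) \<in> C \<longleftrightarrow> c \<le> x \<and> x \<le> r C \<and> y = f C x"
    using admissible_graphs[OF assms] by (elim exE conjE)
  interpret curve_system F f c r by (rule fcr)
  have "tangent_pairs F \<subseteq> touching_pairs F"
  proof
    fix e assume "e \<in> tangent_pairs F"
    then obtain A B where e: "e = {A, B}" "A \<in> F" "B \<in> F" "A \<noteq> B" "tangent A B"
      by (auto simp: tangent_pairs_def)
    then have "below_touching A B \<or> below_touching B A"
      using tangent_below_touching[of "\<lambda>C. C" A B] mem by auto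
    then show "e \<in> touching_pairs F" using e by (auto simp: touching_pairs_def insert_commute)
  qed
  then have "card (tangent_pairs F) \<le> card (touching_pairs F)"
    by (intro card_mono finite_touching_pairs finite_F)
  then have "real (card (tangent_pairs F)) \<le> real (card (touching_pairs F))" by simp
  also have "\<dots> \<le> 600 * real (card F) powr (4 / 3)" by (rule card_touching_pairs) simp
  also have "card F = n" using assms by (simp add: admissible_family_def)
  finally show ?thesis .
qed

lemma T_attained: "\<exists>F. admissible_family n F \<and> T n = card (tangent_pairs F)"
  using Max_in[OF finite_tangency_counts tangency_counts_nonempty, of n] by (auto simp: T_def)

lemma T_ge: "admissible_family n F \<Longrightarrow> card (tangent_pairs F) \<le> T n"
  unfolding T_def by (intro Max_ge finite_tangency_counts) auto

lemma T_upper: "real (T n) \<le> 600 * real n powr (4 / 3)"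
  using T_attained[of n] card_tangent_pairs_le by metis

section \<open>The lower bound\<close>

definition graph_over :: "('a \<Rightarrow> real \<Rightarrow> real) \<Rightarrow> ('a \<Rightarrow> real) \<Rightarrow> 'a \<Rightarrow> point set" where
  "graph_over f r i = (\<lambda>x. (x, f i x)) ` {0..r i}"

lemma mem_graph_over: "(x, y) \<in> graph_over f r i \<longleftrightarrow> 0 \<le> x \<and> x \<le> r i \<and> y = f i x"
  by (auto simp: graph_over_def)

lemma admissible_graph_over:
  assumes "curve_system I f 0 r" and r: "\<And>i. i \<in> I \<Longrightarrow> 0 < r i"
  shows "inj_on (graph_over f r) I" "admissible_family (card I) (graph_over f r ` I)"
proof -
  interpret curve_system I f 0 r by fact
  let ?h = "graph_over f r"
  have once: "p = q" if "i \<in> I" "j \<in> I" "i \<noteq> j" "p \<in> ?h i \<inter> ?h j" "q \<in> ?h i \<inter> ?h j" for i j p q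
  proof -
    obtain x y x' y' where "p = (x, y)" "q = (x', y')" by fastforce
    then show ?thesis using that meet_once[of i j x x'] by (auto simp: mem_graph_over)
  qed
  show inj: "inj_on ?h I"
  proof (rule inj_onI, rule ccontr)
    fix i j assume ij: "i \<in> I" "j \<in> I" "?h i = ?h j" "i \<noteq> j"
    have "(0, f i 0) \<in> ?h i" "(r i, f i (r i)) \<in> ?h i"
      using r[OF ij(1)] by (simp_all add: mem_graph_over)
    then have "(0, f i 0) \<in> ?h i \<inter> ?h j" "(r i, f i (r i)) \<in> ?h i \<inter> ?h j"
      using ij(3) by simp_all
    then have "(0, f i 0) = (r i, f i (r i))" by (rule once[OF ij(1,2,4)])
    then show False using r[OF ij(1)] by simp
  qed
  show "admissible_family (card I) (?h ` I)"
    unfolding admissible_family_def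
  proof (intro conjI)
    show "finite (?h ` I)" using finite_F by simp
    show "card (?h ` I) = card I" using inj by (rule card_image)
    show "\<forall>C\<in>?h ` I. x_monotone C"
      unfolding x_monotone_def graph_over_def using cont r by blast
    show "\<forall>A\<in>?h ` I. \<forall>B\<in>?h ` I. A \<noteq> B \<longrightarrow> finite (A \<inter> B) \<and> card (A \<inter> B) \<le> 1"
    proof (intro ballI impI)
      fix A B assume "A \<in> ?h ` I" "B \<in> ?h ` I" "A \<noteq> B"
      then obtain i j where ij: "i \<in> I" "j \<in> I" "i \<noteq> j" "A = ?h i" "B = ?h j" by auto
      show "finite (A \<inter> B) \<and> card (A \<inter> B) \<le> 1"
      proof (cases "A \<inter> B = {}")
        case False
        then obtain p where "p \<in> A \<inter> B" by blast
        then have "A \<inter> B = {p}" using once[OF ij(1-3)] ij(4,5) by blast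
        then show ?thesis by simp
      qed simp
    qed
    show "\<forall>A\<in>?h ` I. \<forall>B\<in>?h ` I. \<forall>C\<in>?h ` I. A \<noteq> B \<and> A \<noteq> C \<and> B \<noteq> C \<longrightarrow> A \<inter> B \<inter> C = {}"
    proof (intro ballI impI)
      fix A B C assume ABC: "A \<in> ?h ` I" "B \<in> ?h ` I" "C \<in> ?h ` I" "A \<noteq> B \<and> A \<noteq> C \<and> B \<noteq> C"
      then obtain i j k where ijk: "i \<in> I" "j \<in> I" "k \<in> I" "A = ?h i" "B = ?h j" "C = ?h k" by blast
      have "i \<noteq> j" "i \<noteq> k" "j \<noteq> k" using ABC ijk by auto
      then have "(x, y) \<notin> A \<inter> B \<inter> C" for x y
        using no_triple[of i j k x] ijk by (auto simp: mem_graph_over)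
      then show "A \<inter> B \<inter> C = {}" by fastforce
    qed
    show "\<exists>c. \<forall>C\<in>?h ` I. fst (left_endpoint C) = c"
    proof (intro exI[of _ 0] ballI)
      fix C assume "C \<in> ?h ` I"
      then obtain i where "i \<in> I" "C = ?h i" by blast
      then show "fst (left_endpoint C) = 0"
        using left_endpoint_graph[of 0 "r i" "f i"] r[of i] by (simp add: graph_over_def)
    qed
  qed
qed

text \<open>Translates \<open>b - K (x - a)\<^sup>2\<close> of a steep parabola are tangent to \<open>y = m x + l + m\<^sup>2 / 4K\<close> exactly
  if \<open>b = m a + l\<close>, so tangencies are point-line incidences in an integer grid. Left of its
  point of slope \<open>\<sigma>\<close> the parabola is replaced by its tangent there, which is again a line of the
  above form.\<close>

text \<open>The curves \<open>Top i\<close> only pad the family to a prescribed size.\<close>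

datatype label = Line int int | Arc int int | Top int

section \<open>The grid of lines and arcs\<close>

locale grid =
  fixes k :: nat
  assumes k: "k \<ge> 1"
begin

text \<open>Must exceed all line slopes \<open>1..k\<close> and be at least
  \<open>2 * k ^ 2 + 1\<close>, so that in \<open>arc_above_arc\<close> a shift by 1 to the right
  outweighs every difference in height.\<close>

definition \<sigma> :: int where "\<sigma> = 3 * int k ^ 2"
text \<open>The cube bounds a product of three slope differences in \<open>three_lines\<close>; it
  also gives \<open>\<sigma> ^ 2 < K\<close>, which \<open>arc_line_meet\<close> needs.\<close>

definition K :: real where "K = real_of_int \<sigma> ^ 3"

definition line :: "int \<Rightarrow> int \<Rightarrow> real \<Rightarrow> real" where
  "line m l x = m * x + l + m\<^sup>2 / (4 * K)"

definition arc :: "int \<Rightarrow> int \<Rightarrow> real \<Rightarrow> real" where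
  "arc a b x = b - K * (x - a)\<^sup>2 + K * (min 0 (x - a + \<sigma> / (2 * K)))\<^sup>2"

fun curve :: "label \<Rightarrow> real \<Rightarrow> real" where
  "curve (Line m l) = line m l"
| "curve (Arc a b) = arc a b"
| "curve (Top i) = (\<lambda>_. 4 * real k ^ 2 + 2 + i)"

text \<open>An arc ends at its apex \<open>x = a\<close>. With only ascending branches left, no two
  arcs meet.\<close>

fun right_end :: "label \<Rightarrow> real" where
  "right_end (Line m l) = k"
| "right_end (Arc a b) = a"
| "right_end (Top i) = 1"

definition labels :: "nat \<Rightarrow> label set" where
  "labels e = (\<lambda>(m, l). Line m l) ` ({1..int k} \<times> {1..int k ^ 2}) \<union>
     (\<lambda>(a, b). Arc a b) ` ({1..int k} \<times> {1..2 * int k ^ 2}) \<union> Top ` {0..<int e}"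

lemma labels_simps [simp]:
  "Line m l \<in> labels e \<longleftrightarrow> 1 \<le> m \<and> m \<le> k \<and> 1 \<le> l \<and> l \<le> int k ^ 2"
  "Arc a b \<in> labels e \<longleftrightarrow> 1 \<le> a \<and> a \<le> k \<and> 1 \<le> b \<and> b \<le> 2 * int k ^ 2"
  "Top i \<in> labels e \<longleftrightarrow> 0 \<le> i \<and> i < e"
  by (auto simp: labels_def)

lemma k_le: "int k \<le> int k ^ 2" "1 \<le> int k ^ 2"
  using k by (simp_all add: self_le_power)

lemma \<sigma>_bounds: "3 \<le> \<sigma>" "int k < \<sigma>" "2 * int k ^ 2 + 1 \<le> \<sigma>"
  unfolding \<sigma>_def using k_le by linarith+

lemma K_pos: "K > 0" and \<sigma>_pos: "real_of_int \<sigma> > 0"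
  using \<sigma>_bounds by (auto simp: K_def)

lemma K_big: "real_of_int \<sigma> ^ 2 < K" "real_of_int \<sigma> < K"
proof -
  have "1 < real_of_int \<sigma>" using \<sigma>_bounds by simp
  then have "real_of_int \<sigma> ^ 2 < real_of_int \<sigma> ^ 3" "real_of_int \<sigma> ^ 1 < real_of_int \<sigma> ^ 3"
    by (intro power_strict_increasing; simp)+
  then show "real_of_int \<sigma> ^ 2 < K" "real_of_int \<sigma> < K" by (simp_all add: K_def)
qed

lemma arc_linear:
  fixes x :: real
  assumes "x - a \<le> - (\<sigma> / (2 * K))"
  shows "arc a b x = line \<sigma> (b - \<sigma> * a) x"
proof -
  have "arc a b x = b - K * (x - a)\<^sup>2 + K * (x - a + \<sigma> / (2 * K))\<^sup>2"
    using assms by (simp add: arc_def min_absorb2)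
  also have "\<dots> = line \<sigma> (b - \<sigma> * a) x"
    using K_pos by (simp add: line_def power2_eq_square field_simps)
  finally show ?thesis .
qed

lemma arc_minus_line:
  fixes x :: real
  shows "arc a b x - line m l x = (b - m * a - l) - K * (x - a + m / (2 * K))\<^sup>2 + K * (min 0 (x - a + \<sigma> / (2 * K)))\<^sup>2"
proof -
  have "K * (x - a + m / (2 * K))\<^sup>2 = K * (x - a)\<^sup>2 + m * (x - a) + m\<^sup>2 / (4 * K)"
    using K_pos by (simp add: power2_eq_square field_simps)
  then show ?thesis by (simp add: line_def arc_def algebra_simps)
qed

text \<open>At a meeting on the parabolic part the integer \<open>b - m * a - l\<close> equals
  \<open>K * u\<^sup>2\<close>, which is nonnegative and, since \<open>u\<close> is at most
  \<open>\<sigma> / (2 * K)\<close> in absolute value, less than 1. So it is 0 and the line is the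
  tangent.\<close>

lemma arc_line_meet:
  fixes m a b l :: int and x :: real
  assumes m: "1 \<le> m" "m \<le> k" and x: "x \<le> a" "- (\<sigma> / (2 * K)) < x - a" and eq: "arc a b x = line m l x"
  shows "b = m * a + l \<and> x = a - m / (2 * K)"
proof -
  define u where "u = x - a + m / (2 * K)"
  have sq: "b - m * a - l = K * u\<^sup>2"
    using arc_minus_line[of a b x m l] eq x by (simp add: u_def min_absorb1)
  have m\<sigma>: "real_of_int m \<le> \<sigma>" "0 < real_of_int m" using m \<sigma>_bounds by auto
  have "u \<le> m / (2 * K)" using x by (simp add: u_def)
  also have "\<dots> \<le> \<sigma> / (2 * K)" using m\<sigma> K_pos by (intro divide_right_mono) auto
  finally have u1: "u \<le> \<sigma> / (2 * K)" .
  have "0 \<le> m / (2 * K)" using m\<sigma> K_pos by simp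
  then have u2: "- (\<sigma> / (2 * K)) \<le> u" using x by (simp add: u_def)
  have "\<bar>u\<bar> \<le> \<bar>\<sigma> / (2 * K)\<bar>" using u1 u2 by linarith
  then have "u\<^sup>2 \<le> (\<sigma> / (2 * K))\<^sup>2" by (rule abs_le_square_iff[THEN iffD1])
  then have "K * u\<^sup>2 \<le> K * (\<sigma> / (2 * K))\<^sup>2" using K_pos by (intro mult_left_mono) auto
  also have "\<dots> = (\<sigma> ^ 2 / K) / 4" using K_pos by (simp add: power2_eq_square field_simps)
  also have "\<dots> < 1" using K_big K_pos by (simp add: field_simps)
  finally have "real_of_int (b - m * a - l) < 1" using sq by simp
  moreover have "real_of_int (b - m * a - l) \<ge> 0" using sq K_pos by simp
  ultimately have 0: "b - m * a - l = 0" by linarith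
  then have "K * u\<^sup>2 = 0" using sq by simp
  then have "u = 0" using K_pos by simp
  then show ?thesis using 0 by (simp add: u_def)
qed

lemma arc_le_tangent:
  fixes m a l :: int and x :: real
  assumes m: "1 \<le> m" "m \<le> k"
  shows "arc a (m * a + l) x \<le> line m l x"
proof (cases "x - a + \<sigma> / (2 * K) \<le> 0")
  case True
  then have "(x - a + \<sigma> / (2 * K))\<^sup>2 \<le> (x - a + m / (2 * K))\<^sup>2"
  proof -
    have "m / (2 * K) \<le> \<sigma> / (2 * K)" using m \<sigma>_bounds K_pos by (intro divide_right_mono) auto
    then show ?thesis using True by (intro abs_le_square_iff[THEN iffD1]) auto
  qed
  then have "K * (x - a + \<sigma> / (2 * K))\<^sup>2 \<le> K * (x - a + m / (2 * K))\<^sup>2"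
    using K_pos by (intro mult_left_mono) auto
  then show ?thesis using arc_minus_line[of a "m * a + l" x m l] True by (simp add: min_absorb2)
next
  case False
  have "0 \<le> K * (x - a + m / (2 * K))\<^sup>2" using K_pos by simp
  then show ?thesis using arc_minus_line[of a "m * a + l" x m l] False by (simp add: min_absorb1)
qed

lemma arc_at_tangency:
  fixes m a l :: int
  assumes "1 \<le> m" "m \<le> k"
  shows "arc a (m * a + l) (a - m / (2 * K)) = line m l (a - m / (2 * K))"
proof -
  have "m / (2 * K) \<le> \<sigma> / (2 * K)" using assms \<sigma>_bounds K_pos by (intro divide_right_mono) auto
  then show ?thesis
    using arc_minus_line[of a "m * a + l" "a - m / (2 * K)" m l] by (simp add: min_absorb1)
qed

lemma lines_meet:
  fixes x y :: real
  assumes "m \<noteq> m'" "line m l x = line m' l' x" "line m l y = line m' l' y"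
  shows "x = y"
proof -
  have "(real_of_int m - m') * x = (real_of_int m - m') * y"
    using assms(2,3) by (simp add: line_def algebra_simps)
  then show ?thesis using assms(1) by simp
qed

text \<open>Eliminating \<open>x\<close> leaves \<open>I + V / (4 * K) = 0\<close> with an integer
  \<open>I\<close>; the quadratic offsets contribute the Vandermonde product \<open>V\<close> of the
  slopes. Its absolute value is at most \<open>K\<close>, which forces \<open>I = 0\<close> and then
  \<open>V = 0\<close>.\<close>

lemma three_lines:
  fixes x :: real
  assumes m: "m1 \<noteq> m2" "m1 \<noteq> m3" "m2 \<noteq> m3"
    and range: "0 \<le> m1" "m1 \<le> \<sigma>" "0 \<le> m2" "m2 \<le> \<sigma>" "0 \<le> m3" "m3 \<le> \<sigma>"
    and eq: "line m1 l1 x = line m2 l2 x" "line m1 l1 x = line m3 l3 x"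
  shows False
proof -
  define V where "V = (m1 - m3) * (m1 - m2) * (m2 - m3)"
  define I where "I = (m1 - m3) * (l1 - l2) - (m1 - m2) * (l1 - l3)"
  have "(real_of_int m1 - m2) * x + (real_of_int l1 - l2) + (real_of_int m1 ^ 2 - m2 ^ 2) / (4 * K) = 0"
    "(real_of_int m1 - m3) * x + (real_of_int l1 - l3) + (real_of_int m1 ^ 2 - m3 ^ 2) / (4 * K) = 0"
    using eq by (simp_all add: line_def algebra_simps diff_divide_distrib)
  then have "(real_of_int m1 - m3) * ((real_of_int m1 - m2) * x + (real_of_int l1 - l2) + (real_of_int m1 ^ 2 - m2 ^ 2) / (4 * K))
      - (real_of_int m1 - m2) * ((real_of_int m1 - m3) * x + (real_of_int l1 - l3) + (real_of_int m1 ^ 2 - m3 ^ 2) / (4 * K)) = 0"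
    by simp
  moreover have "(real_of_int m1 - m3) * ((real_of_int m1 - m2) * x + (real_of_int l1 - l2) + (real_of_int m1 ^ 2 - m2 ^ 2) / (4 * K))
      - (real_of_int m1 - m2) * ((real_of_int m1 - m3) * x + (real_of_int l1 - l3) + (real_of_int m1 ^ 2 - m3 ^ 2) / (4 * K))
      = I + V / (4 * K)"
    using K_pos by (simp add: I_def V_def field_simps power2_eq_square)
  ultimately have IV: "real_of_int I = - (V / (4 * K))" by simp
  have "\<bar>real_of_int V\<bar> = \<bar>real_of_int m1 - m3\<bar> * \<bar>real_of_int m1 - m2\<bar> * \<bar>real_of_int m2 - m3\<bar>"
    by (simp add: V_def abs_mult)
  also have "\<dots> \<le> real_of_int \<sigma> * real_of_int \<sigma> * real_of_int \<sigma>" using range \<sigma>_pos by (intro mult_mono) auto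
  also have "\<dots> = K" by (simp add: K_def power3_eq_cube)
  finally have "\<bar>V / (4 * K)\<bar> < 1" using K_pos by (simp add: field_simps)
  then have "I = 0" using IV by linarith
  then have "V = 0" using IV K_pos by simp
  then show False using m by (simp add: V_def)
qed

text \<open>Arcs are curved only within distance 1/2 of their apex, so the arc of \<open>a'\<close>
  is on its linear part here. The arc of \<open>a\<close> lies above the line of slope
  \<open>\<sigma>\<close> through its own apex, and moving the apex by at least 1 costs at least
  \<open>\<sigma>\<close> in height.\<close>

lemma arc_above_arc:
  fixes x :: real
  assumes a: "a < a'" and x: "x \<le> a" and b: "1 \<le> b" "b' \<le> 2 * int k ^ 2"
  shows "arc a' b' x < arc a b x"
proof -
  have half: "\<sigma> / (2 * K) < 1 / 2" using K_big K_pos by (simp add: field_simps)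
  have a1: "real_of_int a + 1 \<le> a'" using a by linarith
  have lin: "arc a' b' x = line \<sigma> (b' - \<sigma> * a') x"
    by (rule arc_linear) (use a1 x half in linarith)
  have low: "b + \<sigma> * (x - a) \<le> arc a b x"
  proof (cases "x - a \<le> - (\<sigma> / (2 * K))")
    case True
    then have "arc a b x = line \<sigma> (b - \<sigma> * a) x" by (rule arc_linear)
    then show ?thesis using K_pos by (simp add: line_def algebra_simps)
  next
    case False
    then have "arc a b x = b - K * (x - a)\<^sup>2" by (simp add: arc_def min_absorb1)
    moreover have "K * (a - x) * (a - x) \<le> \<sigma> * (a - x)"
    proof (rule mult_right_mono)
      have "K * (a - x) \<le> K * (\<sigma> / (2 * K))" using False K_pos by (intro mult_left_mono) auto
      also have "\<dots> \<le> \<sigma>" using K_pos \<sigma>_pos by simp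
      finally show "K * (a - x) \<le> \<sigma>" .
    qed (use x in simp)
    ultimately show ?thesis by (simp add: power2_eq_square algebra_simps)
  qed
  have "\<sigma> ^ 2 / (4 * K) < 1" using K_big K_pos by (simp add: field_simps)
  moreover have "\<sigma> * (real_of_int a + 1) \<le> \<sigma> * real_of_int a'" using a1 \<sigma>_pos by (intro mult_left_mono) auto
  moreover have "real_of_int b' + 1 \<le> \<sigma>" using \<sigma>_bounds b by linarith
  moreover have "1 \<le> real_of_int b" using b by simp
  ultimately show ?thesis using low lin by (simp add: line_def algebra_simps)
qed

lemma arc_le:
  fixes x :: real
  assumes "x \<le> a"
  shows "arc a b x \<le> b"
proof (cases "x - a + \<sigma> / (2 * K) \<le> 0")
  case True
  moreover have "0 < \<sigma> / (2 * K)" using K_pos \<sigma>_pos by simp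
  ultimately have "\<bar>x - a + \<sigma> / (2 * K)\<bar> \<le> \<bar>x - a\<bar>" by linarith
  then have "(x - a + \<sigma> / (2 * K))\<^sup>2 \<le> (x - a)\<^sup>2"
    by (rule abs_le_square_iff[THEN iffD1])
  then have "K * (x - a + \<sigma> / (2 * K))\<^sup>2 \<le> K * (x - a)\<^sup>2"
    using K_pos by (intro mult_left_mono) auto
  then show ?thesis using True by (simp add: arc_def min_absorb2)
next
  case False
  then show ?thesis using K_pos by (simp add: arc_def min_absorb1)
qed

lemma below_top:
  assumes "i \<in> labels e" "0 \<le> x" "x \<le> right_end i" "\<not> (\<exists>j. i = Top j)"
  shows "curve i x < 4 * real k ^ 2 + 2"
proof (cases i)
  case (Line m l)
  then have i: "1 \<le> m" "m \<le> k" "1 \<le> l" "l \<le> int k ^ 2" using assms(1) by auto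
  have "m * x \<le> real k * real k" using i assms Line by (intro mult_mono) auto
  moreover have "real_of_int l \<le> real k ^ 2" using i by (metis of_int_le_iff of_int_of_nat_eq of_int_power)
  moreover have "real_of_int m ^ 2 / (4 * K) < 1"
  proof -
    have "real_of_int m ^ 2 \<le> real_of_int \<sigma> ^ 2" using i \<sigma>_bounds by (intro power_mono) auto
    then show ?thesis using K_big K_pos by (simp add: field_simps)
  qed
  moreover have "0 \<le> real k * real k" by simp
  ultimately have "real_of_int m * x + real_of_int l + (real_of_int m)\<^sup>2 / (4 * K) < 4 * real k ^ 2 + 2"
    unfolding power2_eq_square by linarith
  then show ?thesis using Line by (simp add: line_def)
next
  case (Arc a b)
  then have "arc a b x \<le> b" using assms by (intro arc_le) auto
  moreover have "real_of_int b \<le> 2 * real k ^ 2"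
  proof -
    have "b \<le> 2 * int k ^ 2" using assms(1) Arc by simp
    then have "real_of_int b \<le> real_of_int (2 * int k ^ 2)" by (simp only: of_int_le_iff)
    then show ?thesis by simp
  qed
  moreover have "0 \<le> real k ^ 2" by simp
  ultimately have "arc a b x < 4 * real k ^ 2 + 2" by linarith
  then show ?thesis using Arc by simp
qed (use assms in auto)

lemma curves_meet:
  assumes ij: "i \<in> labels e" "j \<in> labels e" "i \<noteq> j"
    and x: "0 \<le> x" "x \<le> right_end i" "x \<le> right_end j" "curve i x = curve j x"
  shows "(\<exists>m l m' l'. i = Line m l \<and> j = Line m' l' \<and> m \<noteq> m') \<or>
    (\<exists>m l a b. i = Line m l \<and> j = Arc a b) \<or> (\<exists>m l a b. j = Line m l \<and> i = Arc a b)"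
proof (cases "(\<exists>t. i = Top t) \<or> (\<exists>t. j = Top t)")
  case True
  then show ?thesis
    using below_top[of i e x] below_top[of j e x] assms by force
next
  case False
  show ?thesis
  proof (cases i; cases j)
    fix a b a' b' assume [simp]: "i = Arc a b" "j = Arc a' b'"
    have "\<not> a < a'" "\<not> a' < a"
      using arc_above_arc[of a a' x b b'] arc_above_arc[of a' a x b' b] assms by auto
    then have "a = a'" by simp
    then show ?thesis using x(4) ij(3) by (simp add: arc_def)
  next
    fix m l m' l' assume [simp]: "i = Line m l" "j = Line m' l'"
    show ?thesis using x(4) ij(3) by (auto simp: line_def)
  qed (use False in auto)
qed

text \<open>A line meeting the parabolic part is tangent there at a prescribed point, and by
  comparison of squares it misses the linear part. On the linear part two lines of different slopes
  meet.\<close>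

lemma line_arc_once:
  fixes x y :: real
  assumes ij: "Line m l \<in> labels e" "Arc a b \<in> labels e"
    and xy: "x \<le> a" "y \<le> a" "line m l x = arc a b x" "line m l y = arc a b y"
  shows "x = y"
proof -
  have m: "1 \<le> m" "m \<le> k" using ij by auto
  have no: False if xy: "x \<le> a" "y \<le> a" "line m l x = arc a b x" "line m l y = arc a b y"
    and x: "- (\<sigma> / (2 * K)) < x - a" and y: "y - a \<le> - (\<sigma> / (2 * K))" for x y :: real
  proof -
    have "b = m * a + l" using arc_line_meet[OF m xy(1) x] xy(3) by simp
    then have "K * (y - a + m / (2 * K))\<^sup>2 = K * (y - a + \<sigma> / (2 * K))\<^sup>2"
      using arc_minus_line[of a b y m l] xy(4) y by (auto simp: min_absorb2)
    then have "(y - a + m / (2 * K))\<^sup>2 = (y - a + \<sigma> / (2 * K))\<^sup>2" using K_pos by simp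
    moreover have "m / (2 * K) < \<sigma> / (2 * K)"
      using m \<sigma>_bounds K_pos by (intro divide_strict_right_mono) auto
    ultimately show False using y by (auto simp: power2_eq_iff)
  qed
  show ?thesis
  proof (cases "x - a \<le> - (\<sigma> / (2 * K))"; cases "y - a \<le> - (\<sigma> / (2 * K))")
    assume "x - a \<le> - (\<sigma> / (2 * K))" "y - a \<le> - (\<sigma> / (2 * K))"
    then show ?thesis
      using lines_meet[of m \<sigma> l x "b - \<sigma> * a" y] arc_linear[of x a b] arc_linear[of y a b] xy m \<sigma>_bounds by auto
  next
    assume "\<not> x - a \<le> - (\<sigma> / (2 * K))" "\<not> y - a \<le> - (\<sigma> / (2 * K))"
    then show ?thesis
      using arc_line_meet[OF m xy(1), of b l] arc_line_meet[OF m xy(2), of b l] xy by auto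
  next
    assume "\<not> x - a \<le> - (\<sigma> / (2 * K))" "y - a \<le> - (\<sigma> / (2 * K))"
    then show ?thesis using no[of x y] xy by auto
  next
    assume "x - a \<le> - (\<sigma> / (2 * K))" "\<not> y - a \<le> - (\<sigma> / (2 * K))"
    then show ?thesis using no[of y x] xy by auto
  qed
qed

text \<open>On the linear part the arc is a third line, of slope \<open>\<sigma>\<close>; on the
  parabolic part the position of a tangency determines the slope.\<close>

lemma line_line_arc:
  fixes x :: real
  assumes ij: "Line m l \<in> labels e" "Line m' l' \<in> labels e" "Arc a b \<in> labels e" "m \<noteq> m'"
    and x: "x \<le> a" "line m l x = arc a b x" "line m' l' x = arc a b x"
  shows False
proof -
  have m: "1 \<le> m" "m \<le> k" "1 \<le> m'" "m' \<le> k" using ij by auto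
  show False
  proof (cases "x - a \<le> - (\<sigma> / (2 * K))")
    case True
    then show False
      using three_lines[of m m' \<sigma> l x l' "b - \<sigma> * a"] arc_linear[of x a b] x m ij(4) \<sigma>_bounds by auto
  next
    case False
    then have "x = a - m / (2 * K)" "x = a - m' / (2 * K)"
      using arc_line_meet[OF m(1,2) x(1), of b l] arc_line_meet[OF m(3,4) x(1), of b l'] x by auto
    then show False using ij(4) K_pos by simp
  qed
qed

lemma grid_system: "curve_system (labels e) curve 0 right_end"
proof
  show "finite (labels e)" by (simp add: labels_def)
  show "continuous_on {0..right_end i} (curve i)" for i
    by (cases i) (auto simp: line_def[abs_def] arc_def[abs_def] intro!: continuous_intros)
  show "s = t" if ij: "i \<in> labels e" "j \<in> labels e" "i \<noteq> j" and s: "0 \<le> s" "s \<le> right_end i" "s \<le> right_end j"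
    and t: "0 \<le> t" "t \<le> right_end i" "t \<le> right_end j" and eq: "curve i s = curve j s" "curve i t = curve j t" for i j s t
    using curves_meet[OF ij s eq(1)]
  proof (elim disjE exE conjE)
    fix m l m' l' assume "i = Line m l" "j = Line m' l'" "m \<noteq> m'"
    then show ?thesis using lines_meet eq by auto
  next
    fix m l a b assume "i = Line m l" "j = Arc a b"
    then show ?thesis using line_arc_once[of m l e a b s t] ij s t eq by auto
  next
    fix m l a b assume "j = Line m l" "i = Arc a b"
    then show ?thesis using line_arc_once[of m l e a b s t] ij s t eq by auto
  qed
  show False if ij: "i \<in> labels e" "j \<in> labels e" "h \<in> labels e" "i \<noteq> j" "i \<noteq> h" "j \<noteq> h"
    and t: "0 \<le> t" "t \<le> right_end i" "t \<le> right_end j" "t \<le> right_end h"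
    and eq: "curve i t = curve j t" "curve i t = curve h t" for i j h t
  proof -
    have 1: "(\<exists>m l m' l'. i = Line m l \<and> j = Line m' l' \<and> m \<noteq> m') \<or>
      (\<exists>m l a b. i = Line m l \<and> j = Arc a b) \<or> (\<exists>m l a b. j = Line m l \<and> i = Arc a b)"
      by (rule curves_meet[OF ij(1,2,4) t(1,2,3) eq(1)])
    have 2: "(\<exists>m l m' l'. i = Line m l \<and> h = Line m' l' \<and> m \<noteq> m') \<or>
      (\<exists>m l a b. i = Line m l \<and> h = Arc a b) \<or> (\<exists>m l a b. h = Line m l \<and> i = Arc a b)"
      by (rule curves_meet[OF ij(1,3,5) t(1,2,4) eq(2)])
    have 3: "(\<exists>m l m' l'. j = Line m l \<and> h = Line m' l' \<and> m \<noteq> m') \<or>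
      (\<exists>m l a b. j = Line m l \<and> h = Arc a b) \<or> (\<exists>m l a b. h = Line m l \<and> j = Arc a b)"
      by (rule curves_meet[OF ij(2,3,6) t(1,3,4)]) (use eq in simp)
    show False
    proof (cases i)
      case i: (Line m l)
      show False
      proof (cases j)
        case j: (Line m' l')
        have "m \<noteq> m'" using 1 i j by auto
        show False
        proof (cases h)
          case h: (Line m'' l'')
          have "m \<noteq> m''" "m' \<noteq> m''" using 2 3 i j h by auto
          moreover have "0 \<le> m" "m \<le> \<sigma>" "0 \<le> m'" "m' \<le> \<sigma>" "0 \<le> m''" "m'' \<le> \<sigma>"
            using ij i j h \<sigma>_bounds by simp_all
          ultimately show False
            using three_lines[of m m' m'' l t l' l''] \<open>m \<noteq> m'\<close> eq i j h by simp
        next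
          case h: (Arc a b)
          show False
            by (rule line_line_arc[OF ij(1)[unfolded i] ij(2)[unfolded j] ij(3)[unfolded h] \<open>m \<noteq> m'\<close>])
              (use i j h t(4) eq in auto)
        qed (use 2 in auto)
      next
        case j: (Arc a b)
        show False
        proof (cases h)
          case h: (Line m'' l'')
          have "m \<noteq> m''" using 2 i h by auto
          show False
            by (rule line_line_arc[OF ij(1)[unfolded i] ij(3)[unfolded h] ij(2)[unfolded j] \<open>m \<noteq> m''\<close>])
              (use i j h t(3) eq in auto)
        qed (use 3 j in auto)
      qed (use 1 in auto)
    next
      case i: (Arc a b)
      obtain m l where j: "j = Line m l" using 1 i by auto
      obtain m' l' where h: "h = Line m' l'" using 2 i by auto
      have "m \<noteq> m'" using 3 j h by auto
      show False
        by (rule line_line_arc[OF ij(2)[unfolded j] ij(3)[unfolded h] ij(1)[unfolded i] \<open>m \<noteq> m'\<close>])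
          (use i j h t(2) eq in auto)
    qed (use 1 in auto)
  qed
qed

lemma card_labels: "card (labels e) = 3 * k ^ 3 + e"
proof -
  have "card ((\<lambda>(m, l). Line m l) ` ({1..int k} \<times> {1..int k ^ 2})) = k * k ^ 2"
    by (subst card_image) (auto simp: inj_on_def card_cartesian_product nat_power_eq)
  moreover have "card ((\<lambda>(a, b). Arc a b) ` ({1..int k} \<times> {1..2 * int k ^ 2})) = k * (2 * k ^ 2)"
    by (subst card_image) (auto simp: inj_on_def card_cartesian_product nat_mult_distrib nat_power_eq)
  moreover have "card (Top ` {0..<int e}) = e"
    by (subst card_image) (auto simp: inj_on_def)
  ultimately show ?thesis
    unfolding labels_def by (subst card_Un_disjoint, simp, simp, force, subst card_Un_disjoint, simp, simp, force)
      (simp add: power2_eq_square power3_eq_cube)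
qed

lemma tangent_line_arc:
  assumes "Line m l \<in> labels e" "Arc a b \<in> labels e" "b = m * a + l"
  shows "tangent (graph_over curve right_end (Line m l)) (graph_over curve right_end (Arc a b))"
proof -
  interpret curve_system "labels e" curve 0 right_end by (rule grid_system)
  let ?A = "graph_over curve right_end (Line m l)" and ?B = "graph_over curve right_end (Arc a b)"
  let ?x = "a - m / (2 * K)"
  have m: "1 \<le> m" "m \<le> k" "1 \<le> a" "a \<le> k" using assms by auto
  have "m / (2 * K) \<le> 1"
  proof -
    have "real_of_int m \<le> K" using m \<sigma>_bounds K_big by linarith
    then show ?thesis using K_pos by (simp add: field_simps)
  qed
  moreover have "0 \<le> m / (2 * K)" using m K_pos by simp
  ultimately have x: "0 \<le> ?x" "?x \<le> a" "?x \<le> k" using m by linarith+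
  have p: "(?x, line m l ?x) \<in> ?A \<inter> ?B"
    using x arc_at_tangency[OF m(1,2), of a l] assms(3) by (simp add: mem_graph_over)
  have "q = (?x, line m l ?x)" if "q \<in> ?A \<inter> ?B" for q
  proof -
    obtain y z where "q = (y, z)" by fastforce
    then show ?thesis
      using that p meet_once[of "Line m l" "Arc a b" y ?x] assms by (auto simp: mem_graph_over)
  qed
  then have "?A \<inter> ?B = {(?x, line m l ?x)}" using p by blast
  moreover have no: "\<not> strictly_below_on {y<..<z} ?A ?B" if "y < z" for y z
  proof
    assume "strictly_below_on {y<..<z} ?A ?B"
    moreover have "(y + z) / 2 \<in> {y<..<z}" using that by simp
    ultimately have "line m l ((y + z) / 2) < arc a b ((y + z) / 2)"
      unfolding strictly_below_on_def mem_graph_over by fastforce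
    then show False using arc_le_tangent[OF m(1,2), of a l "(y + z) / 2"] assms(3) by simp
  qed
  have "\<not> crossing_point ?A ?B (?x, line m l ?x)"
    unfolding crossing_point_def using no by auto
  ultimately show ?thesis unfolding tangent_def by blast
qed

text \<open>Each triple \<open>(m, a, l)\<close> yields the incidence with
  \<open>b = m * a + l\<close>. Since \<open>m * a\<close> and \<open>l\<close> are at most
  \<open>k ^ 2\<close>, arcs are provided at heights up to \<open>2 * k ^ 2\<close>.\<close>

lemma T_grid: "k ^ 4 \<le> T (3 * k ^ 3 + e)"
proof -
  let ?h = "graph_over curve right_end"
  let ?S = "{1..int k} \<times> {1..int k} \<times> {1..int k ^ 2}"
  let ?g = "\<lambda>(m, a, l). {?h (Line m l), ?h (Arc a (m * a + l))}"
  have pos: "0 < right_end i" if "i \<in> labels e" for i using that k by (cases i) auto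
  note adm = admissible_graph_over[OF grid_system pos, of e]
  have lab: "Line m l \<in> labels e" "Arc a (m * a + l) \<in> labels e" if "(m, a, l) \<in> ?S" for m a l
  proof -
    have "m * a \<le> int k * int k" by (rule mult_mono) (use that in auto)
    moreover have "1 * 1 \<le> m * a" by (rule mult_mono) (use that in auto)
    ultimately have "1 \<le> m * a" "m * a \<le> int k ^ 2" by (simp_all add: power2_eq_square)
    then show "Line m l \<in> labels e" "Arc a (m * a + l) \<in> labels e"
      using that by auto
  qed
  have "inj_on ?g ?S"
  proof (rule inj_onI)
    fix x y assume xy: "x \<in> ?S" "y \<in> ?S" "?g x = ?g y"
    obtain m a l where x: "x = (m, a, l)" by (metis prod.collapse)
    obtain m' a' l' where y: "y = (m', a', l')" by (metis prod.collapse)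
    have eq: "?h ` {Line m l, Arc a (m * a + l)} = ?h ` {Line m' l', Arc a' (m' * a' + l')}"
      using xy(3) x y by simp
    have "{Line m l, Arc a (m * a + l)} = {Line m' l', Arc a' (m' * a' + l')}"
      by (rule inj_on_image_eq_iff[THEN iffD1, OF adm(1) _ _ eq])
        (use lab[of m a l] lab[of m' a' l'] xy x y in auto)
    then show "x = y" using x y by (auto simp: doubleton_eq_iff)
  qed
  then have card: "card (?g ` ?S) = k ^ 4"
    by (subst card_image) (auto simp: card_cartesian_product nat_mult_distrib power2_eq_square power4_eq_xxxx)
  have sub: "?g ` ?S \<subseteq> tangent_pairs (?h ` labels e)"
  proof
    fix z assume "z \<in> ?g ` ?S"
    then obtain m a l where s: "(m, a, l) \<in> ?S" and z: "z = {?h (Line m l), ?h (Arc a (m * a + l))}"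
      by auto
    note L = lab[OF s]
    have "?h (Line m l) \<noteq> ?h (Arc a (m * a + l))"
      using adm(1) L by (auto dest: inj_onD)
    then show "z \<in> tangent_pairs (?h ` labels e)"
      using tangent_line_arc[OF L] L unfolding tangent_pairs_def z by blast
  qed
  have fin: "finite (tangent_pairs (?h ` labels e))"
    by (rule finite_subset[of _ "Pow (?h ` labels e)"]) (auto simp: tangent_pairs_def labels_def)
  have "k ^ 4 \<le> card (tangent_pairs (?h ` labels e))"
    using card_mono[OF fin sub] unfolding card .
  also have "\<dots> \<le> T (card (labels e))" by (rule T_ge[OF adm(2)])
  finally show ?thesis by (simp add: card_labels)
qed

end

section \<open>Arbitrary sizes and the asymptotic statement\<close>

lemma T_lower:
  assumes "n \<ge> 3"
  shows "real (T n) \<ge> (1 / 24) powr (4 / 3) * real n powr (4 / 3)"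
proof -
  have "\<exists>k. 3 * k ^ 3 \<le> n \<and> n < 3 * (k + 1) ^ 3"
  proof -
    define k where "k = (LEAST j. n < 3 * (j + 1) ^ 3)"
    have "n + 1 \<le> (n + 1) ^ 3" by (rule self_le_power) auto
    then have "n < 3 * (n + 1) ^ 3" by linarith
    then have 1: "n < 3 * (k + 1) ^ 3" unfolding k_def by (rule LeastI)
    then have "k \<noteq> 0" using assms by (cases "k = 0") auto
    then obtain j where j: "k = Suc j" using not0_implies_Suc by blast
    then have "\<not> n < 3 * (j + 1) ^ 3" unfolding k_def by (intro not_less_Least) simp
    then have "3 * k ^ 3 \<le> n" using j by simp
    then show ?thesis using 1 by blast
  qed
  then obtain k where kn: "3 * k ^ 3 \<le> n" "n < 3 * (k + 1) ^ 3" by blast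
  have k1: "k \<ge> 1" using kn assms by (cases "k = 0") auto
  interpret grid k by unfold_locales (rule k1)
  \<comment> \<open>The curves \<open>Top i\<close> make up the difference between
    \<open>3 * k ^ 3\<close> and \<open>n\<close>.\<close>
  have "k ^ 4 \<le> T n" using T_grid[of "n - 3 * k ^ 3"] unfolding le_add_diff_inverse[OF kn(1)] .
  \<comment> \<open>The bound \<open>k + 1 \<le> 2 * k\<close> gives \<open>24 = 3 * 2 ^ 3\<close>,
    the source of the factor \<open>1 / 24\<close>.\<close>
  have "n < 3 * (2 * k) ^ 3"
    using kn(2) power_mono[of "k + 1" "2 * k" 3] k1 by simp
  then have "n < 24 * k ^ 3" by (simp add: power_mult_distrib)
  then have "real n < 24 * real k ^ 3" using of_nat_less_iff[of n "24 * k ^ 3", where 'a = real] by simp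
  then have "(1 / 24 * real n) powr (4 / 3) \<le> (real k ^ 3) powr (4 / 3)"
    by (intro powr_mono2) auto
  also have "real k ^ 3 = real k powr 3" using k1 by simp
  also have "(real k powr 3) powr (4 / 3) = real k powr 4" by (simp only: powr_powr) simp
  also have "\<dots> = real (k ^ 4)" using k1 by simp
  also have "\<dots> \<le> real (T n)" using \<open>k ^ 4 \<le> T n\<close> by (rule of_nat_mono)
  finally show ?thesis by (simp add: powr_mult powr_divide)
qed

theorem theorem6: "(\<lambda>n. real (T n)) \<in> \<Theta>(\<lambda>n. real n powr (4 / 3))"
proof (rule bigthetaI)
  show "(\<lambda>n. real (T n)) \<in> O(\<lambda>n. real n powr (4 / 3))"
    by (rule bigoI[of _ 600]) (use T_upper in auto)
  show "(\<lambda>n. real (T n)) \<in> \<Omega>(\<lambda>n. real n powr (4 / 3))"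
    by (rule landau_omega.bigI[of "(1 / 24) powr (4 / 3)"])
      (use T_lower in \<open>auto simp: eventually_at_top_linorder\<close>)
qed

end
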